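(* There are constants $\epsilon_0>0$ and $C>0$ such that for all $\epsilon\in[0,\epsilon_0]$, all $\nu\in(0,1]$, all $k\in\mathbb{Z}$ with $|k|\ge1$, all $\lambda\in\mathbb{R}$ and all $F\in H^{-1}(I)$, if $\varphi\in H^3(I)$ satisfies $$-\nu(\partial_y^2-k^2)^2\varphi+ik(y-\lambda)(\partial_y^2-k^2)\varphi-\epsilon\nu^{1/3}|k|^{2/3}(\partial_y^2-k^2)\varphi=F,\qquad \varphi(\pm1)=0,\ \varphi''(\pm1)=0,$$ then $$(\nu k^2)^{1/2}\|u\|_{L^2}+\nu\|w'\|_{L^2}+\nu^{2/3}|k|^{1/3}\|w\|_{L^2}\le C\|F\|_{H^{-1}},$$ where $u=(\partial_y\varphi,-ik\varphi)$ and $w=(\partial_y^2-k^2)\varphi$.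
   Context: $I=(-1,1)$; functions are complex-valued; all norms are over $I$; $H^{-1}(I)$ is the dual of $H^1_0(I)$ (with the $H^1$ norm); $'$ denotes $d/dy$. *)

theory Defs
  imports "HOL-Analysis.Analysis"
begin

abbreviation I_dom :: "real set" where
  "I_dom \<equiv> {-1<..<1}"

abbreviation I_meas :: "real measure" where
  "I_meas \<equiv> lebesgue_on I_dom"


section \<open>Test functions and square-integrable functions\<close>

definition vderiv :: "(real \<Rightarrow> complex) \<Rightarrow> real \<Rightarrow> complex" where
  "vderiv f = (\<lambda>y. vector_derivative f (at y))"

text \<open>The space of smooth functions with compact support in \<open>I\<close>, extended by zero to the real line.\<close>

definition test_fun :: "(real \<Rightarrow> complex) set" where
  "test_fun = {\<psi>. (\<forall>n y. (vderiv ^^ n) \<psi> differentiable at y) \<and>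
                   (\<exists>K. compact K \<and> K \<subseteq> I_dom \<and> (\<forall>y. y \<notin> K \<longrightarrow> \<psi> y = 0))}"

text \<open>Elements of \<open>L\<^sup>2(I)\<close> are represented by functions on the real line, whose values outside
  \<open>I\<close> and on null sets are irrelevant.\<close>

definition L2 :: "(real \<Rightarrow> complex) set" where
  "L2 = {f \<in> borel_measurable I_meas. integrable I_meas (\<lambda>y. (norm (f y))\<^sup>2)}"

text \<open>The norm is also used for functions with values in \<open>\<complex> \<times> \<complex>\<close>, where the pointwise norm is
  the Euclidean one.\<close>

definition L2_norm :: "(real \<Rightarrow> 'a::real_normed_vector) \<Rightarrow> real" where
  "L2_norm f = sqrt (LINT y|I_meas. (norm (f y))\<^sup>2)"


section \<open>Sobolev spaces\<close>

text \<open>The \<open>j\<close>-th weak derivative of \<open>f \<in> L\<^sup>2(I)\<close> is \<open>g \<in> L\<^sup>2(I)\<close>.\<close>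

definition has_weak_deriv :: "nat \<Rightarrow> (real \<Rightarrow> complex) \<Rightarrow> (real \<Rightarrow> complex) \<Rightarrow> bool" where
  "has_weak_deriv j f g \<longleftrightarrow> f \<in> L2 \<and> g \<in> L2 \<and>
     (\<forall>\<psi>\<in>test_fun. (LINT y|I_meas. f y * (vderiv ^^ j) \<psi> y) = (-1) ^ j * (LINT y|I_meas. g y * \<psi> y))"

text \<open>A representative of the weak derivative, which is unique up to null sets in \<open>I\<close>; it is
  unspecified if there is no weak derivative in \<open>L\<^sup>2(I)\<close>.\<close>

definition weak_deriv :: "nat \<Rightarrow> (real \<Rightarrow> complex) \<Rightarrow> real \<Rightarrow> complex" where
  "weak_deriv j f = (SOME g. has_weak_deriv j f g)"

definition Sobolev :: "nat \<Rightarrow> (real \<Rightarrow> complex) set" where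
  "Sobolev m = {f. \<forall>j\<le>m. \<exists>g. has_weak_deriv j f g}"

definition H1_norm :: "(real \<Rightarrow> complex) \<Rightarrow> real" where
  "H1_norm f = sqrt ((L2_norm f)\<^sup>2 + (L2_norm (weak_deriv 1 f))\<^sup>2)"

text \<open>\<open>H\<^sup>1\<^sub>0(I)\<close> is the closure of the test functions in \<open>H\<^sup>1(I)\<close>.\<close>

definition H10 :: "(real \<Rightarrow> complex) set" where
  "H10 = {f \<in> Sobolev 1. \<forall>e>0. \<exists>\<psi>\<in>test_fun. H1_norm (\<lambda>y. f y - \<psi> y) < e}"

text \<open>The value at a point \<open>a\<close> of \<open>[-1,1]\<close>, in particular at an endpoint, is that of the continuous
  representative on \<open>[-1,1]\<close>.\<close>

definition has_trace :: "(real \<Rightarrow> complex) \<Rightarrow> real \<Rightarrow> complex \<Rightarrow> bool" where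
  "has_trace f a c \<longleftrightarrow>
     (\<exists>g. continuous_on {-1..1} g \<and> (AE y in I_meas. f y = g y) \<and> g a = c)"


section \<open>The dual of \<open>H\<^sup>1\<^sub>0(I)\<close>\<close>

text \<open>Bounded complex-linear functionals on \<open>H\<^sup>1\<^sub>0(I)\<close>. Boundedness makes them independent of the
  choice of representatives; the values outside \<open>H10\<close> are irrelevant.\<close>

definition Hminus1 :: "((real \<Rightarrow> complex) \<Rightarrow> complex) set" where
  "Hminus1 = {F. (\<forall>f\<in>H10. \<forall>g\<in>H10. F (\<lambda>y. f y + g y) = F f + F g) \<and>
                 (\<forall>c. \<forall>f\<in>H10. F (\<lambda>y. c * f y) = c * F f) \<and>
                 (\<exists>B. \<forall>f\<in>H10. norm (F f) \<le> B * H1_norm f)}"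

definition Hminus1_norm :: "((real \<Rightarrow> complex) \<Rightarrow> complex) \<Rightarrow> real" where
  "Hminus1_norm F = (SUP f \<in> {f \<in> H10. H1_norm f \<le> 1}. norm (F f))"


section \<open>Distributions on \<open>I\<close>\<close>

text \<open>The following operations on functionals on test functions extend the corresponding operations
  on functions. An element of \<open>Hminus1\<close> is a distribution by restriction to \<open>test_fun\<close>.\<close>

type_synonym distr = "(real \<Rightarrow> complex) \<Rightarrow> complex"

definition distr_of :: "(real \<Rightarrow> complex) \<Rightarrow> distr" where
  "distr_of f = (\<lambda>\<psi>. LINT y|I_meas. f y * \<psi> y)"

definition distr_deriv :: "distr \<Rightarrow> distr" where
  "distr_deriv T = (\<lambda>\<psi>. - T (vderiv \<psi>))"

definition distr_mult :: "(real \<Rightarrow> complex) \<Rightarrow> distr \<Rightarrow> distr" where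
  "distr_mult a T = (\<lambda>\<psi>. T (\<lambda>y. a y * \<psi> y))"

text \<open>The operator \<open>\<partial>\<^sub>y\<^sup>2 - k\<^sup>2\<close>.\<close>

definition Lap :: "int \<Rightarrow> distr \<Rightarrow> distr" where
  "Lap k T = (\<lambda>\<psi>. distr_deriv (distr_deriv T) \<psi> - of_int k ^ 2 * T \<psi>)"

text \<open>The equation, as an identity of distributions on \<open>I\<close>.\<close>

definition OS_equation ::
  "real \<Rightarrow> real \<Rightarrow> int \<Rightarrow> real \<Rightarrow> (real \<Rightarrow> complex) \<Rightarrow> ((real \<Rightarrow> complex) \<Rightarrow> complex) \<Rightarrow> bool" where
  "OS_equation \<epsilon> \<nu> k lam \<phi> F \<longleftrightarrow>
     (\<forall>\<psi>\<in>test_fun.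
        - of_real \<nu> * Lap k (Lap k (distr_of \<phi>)) \<psi>
        + \<i> * of_int k * distr_mult (\<lambda>y. of_real (y - lam)) (Lap k (distr_of \<phi>)) \<psi>
        - of_real (\<epsilon> * \<nu> powr (1/3) * \<bar>real_of_int k\<bar> powr (2/3)) * Lap k (distr_of \<phi>) \<psi>
        = F \<psi>)"

definition velocity :: "int \<Rightarrow> (real \<Rightarrow> complex) \<Rightarrow> real \<Rightarrow> complex \<times> complex" where
  "velocity k \<phi> = (\<lambda>y. (weak_deriv 1 \<phi> y, - \<i> * of_int k * \<phi> y))"

definition vorticity :: "int \<Rightarrow> (real \<Rightarrow> complex) \<Rightarrow> real \<Rightarrow> complex" where
  "vorticity k \<phi> = (\<lambda>y. weak_deriv 2 \<phi> y - of_int k ^ 2 * \<phi> y)"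

end

theory Submission
  imports Defs "HOL-Real_Asymp.Real_Asymp"
begin

text \<open>Write \<open>h = (\<nu>/|k|)\<^bsup>1/3\<^esup>\<close> for the width of the critical layer around \<open>\<lambda>\<close>. Both \<open>w\<close> and
  \<open>\<phi>\<close> lie in \<open>H\<^sup>1\<^sub>0\<close>, so the weak equation may be tested with \<open>w\<close> (energy identity) and with
  \<open>f (y - \<lambda>) / ((y - \<lambda>)\<^sup>2 + h\<^sup>2)\<close> for \<open>f = w\<close> and \<open>f = \<phi>\<close>. The transport term then yields
  \<open>|k| |\<langle>w, f\<rangle>|\<close> up to a contribution of the layer, which is small because
  \<open>\<parallel>f\<parallel>\<^sub>\<infinity>\<^sup>2 \<le> 2 \<parallel>f\<parallel> \<parallel>f'\<parallel>\<close> and \<open>\<integral> dy / ((y - \<lambda>)\<^sup>2 + h\<^sup>2) \<le> \<pi> / h\<close>. With \<open>f = w\<close> and the energy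
  identity this bounds \<open>w\<close> and \<open>w'\<close>; with \<open>f = \<phi>\<close>, where \<open>\<langle>w, \<phi>\<rangle> = - \<parallel>u\<parallel>\<^sup>2\<close>, it bounds \<open>u\<close> if
  \<open>\<nu> k\<^sup>2 \<le> 1\<close>, and if \<open>\<nu> k\<^sup>2 \<ge> 1\<close> the energy bound suffices.\<close>

section \<open>The space \<open>L\<^sup>2(I)\<close>\<close>

text \<open>With |k| h^3 = \<nu>, the coefficient of the \<epsilon>-term is exactly \<epsilon> \<nu>
  / h^2. In the energy identity it has the size of diffusion at the scale of the layer, but the
  wrong sign, so that identity does not close alone. The multiplier estimate controls the norm of w
  divided by h, which is what absorbs the bad term, but it needs the energy as input. Smallness of
  \<epsilon>, and nothing else, breaks this circle. The natural multiplier 1 / (y - \<lambda>) is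
  singular inside I. Its regularisation at scale h is smooth, is bounded by 1 / h, and has a
  derivative dominated by a weight whose integral is bounded uniformly in \<lambda>; so no case
  distinction on the position of \<lambda> relative to I is made. As F lies only in H^{-1}, each
  test function must vanish at the end points and is charged for its derivative. The equation is
  stated against smooth functions of compact support, whereas w, \<phi> and their products with the
  multiplier are only H^1 limits of such functions. Much of the preparation serves this passage to
  the limit.\<close>

lemma L2I:
  assumes "f \<in> borel_measurable I_meas" "integrable I_meas (\<lambda>y. (norm (f y))\<^sup>2)"
  shows "f \<in> L2"
  using assms by (simp add: L2_def)

lemma L2D:
  assumes "f \<in> L2"
  shows "f \<in> borel_measurable I_meas" "integrable I_meas (\<lambda>y. (norm (f y))\<^sup>2)"
  using assms by (simp_all add: L2_def)

lemma L2_norm_nonneg [simp]: "0 \<le> L2_norm f"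
  by (simp add: L2_norm_def)

lemma L2_norm_power2: "(L2_norm f)\<^sup>2 = (LINT y|I_meas. (norm (f y))\<^sup>2)"
  by (simp add: L2_norm_def)

lemma L2_norm_zero [simp]: "L2_norm (\<lambda>y. 0) = 0"
  by (simp add: L2_norm_def)

lemma L2_bounded_mult:
  assumes f: "f \<in> L2" and a: "a \<in> borel_measurable I_meas" and B: "\<And>y. y \<in> I_dom \<Longrightarrow> norm (a y) \<le> B"
  shows "(\<lambda>y. a y * f y) \<in> L2"
proof (rule L2I)
  show m: "(\<lambda>y. a y * f y) \<in> borel_measurable I_meas"
    using a L2D(1)[OF f] by measurable
  have m2: "(\<lambda>y. (norm (a y * f y))\<^sup>2) \<in> borel_measurable I_meas"
    using m by measurable
  show "integrable I_meas (\<lambda>y. (norm (a y * f y))\<^sup>2)"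
  proof (rule Bochner_Integration.integrable_bound)
    show "integrable I_meas (\<lambda>y. B\<^sup>2 * (norm (f y))\<^sup>2)"
      using L2D(2)[OF f] by simp
    show "AE y in I_meas. norm ((norm (a y * f y))\<^sup>2) \<le> norm (B\<^sup>2 * (norm (f y))\<^sup>2)"
    proof (rule AE_I2)
      fix y assume "y \<in> space I_meas"
      then have "norm (a y) \<le> B" using B by simp
      then have "(norm (a y) * norm (f y))\<^sup>2 \<le> (B * norm (f y))\<^sup>2"
        by (intro power_mono mult_right_mono) auto
      then show "norm ((norm (a y * f y))\<^sup>2) \<le> norm (B\<^sup>2 * (norm (f y))\<^sup>2)"
        by (simp add: norm_mult power_mult_distrib)
    qed
  qed (use m2 in auto)
qed

lemma L2_cmult: "f \<in> L2 \<Longrightarrow> (\<lambda>y. c * f y) \<in> L2"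
  by (rule L2_bounded_mult[where B="norm c"]) auto

lemma L2_cnj:
  assumes "f \<in> L2" shows "(\<lambda>y. cnj (f y)) \<in> L2"
proof (rule L2I)
  show "(\<lambda>y. cnj (f y)) \<in> borel_measurable I_meas"
    using L2D(1)[OF assms] by (rule borel_measurable_continuous_on[of cnj, rotated]) (intro continuous_intros)
qed (use L2D(2)[OF assms] in simp)

lemma L2_add:
  assumes f: "f \<in> L2" and g: "g \<in> L2"
  shows "(\<lambda>y. f y + g y) \<in> L2"
proof (rule L2I)
  show m: "(\<lambda>y. f y + g y) \<in> borel_measurable I_meas"
    using L2D(1)[OF f] L2D(1)[OF g] by measurable
  have m2: "(\<lambda>y. (norm (f y + g y))\<^sup>2) \<in> borel_measurable I_meas"
    using m by measurable
  show "integrable I_meas (\<lambda>y. (norm (f y + g y))\<^sup>2)"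
  proof (rule Bochner_Integration.integrable_bound)
    show "integrable I_meas (\<lambda>y. 2 * (norm (f y))\<^sup>2 + 2 * (norm (g y))\<^sup>2)"
      using L2D(2)[OF f] L2D(2)[OF g] by simp
    have "(norm (f y + g y))\<^sup>2 \<le> 2 * (norm (f y))\<^sup>2 + 2 * (norm (g y))\<^sup>2" for y
    proof -
      have "(norm (f y + g y))\<^sup>2 \<le> (norm (f y) + norm (g y))\<^sup>2"
        by (intro power_mono norm_triangle_ineq) auto
      also have "\<dots> \<le> 2 * (norm (f y))\<^sup>2 + 2 * (norm (g y))\<^sup>2"
        using sum_squares_bound[of "norm (f y)" "norm (g y)"] by (simp add: power2_sum)
      finally show ?thesis .
    qed
    then show "AE y in I_meas. norm ((norm (f y + g y))\<^sup>2) \<le> norm (2 * (norm (f y))\<^sup>2 + 2 * (norm (g y))\<^sup>2)"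
      by (intro AE_I2) simp
  qed (use m2 in auto)
qed

lemma L2_diff: "f \<in> L2 \<Longrightarrow> g \<in> L2 \<Longrightarrow> (\<lambda>y. f y - g y) \<in> L2"
  using L2_add[of f "\<lambda>y. (-1) * g y"] L2_cmult[of g "-1"] by simp

lemma L2_mult_integrable:
  assumes f: "f \<in> L2" and g: "g \<in> L2"
  shows "integrable I_meas (\<lambda>y. f y * g y)" "integrable I_meas (\<lambda>y. norm (f y) * norm (g y))"
proof -
  have m: "(\<lambda>y. f y * g y) \<in> borel_measurable I_meas"
    using L2D(1)[OF f] L2D(1)[OF g] by measurable
  show 1: "integrable I_meas (\<lambda>y. f y * g y)"
  proof (rule Bochner_Integration.integrable_bound)
    show "integrable I_meas (\<lambda>y. (norm (f y))\<^sup>2 + (norm (g y))\<^sup>2)"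
      using L2D(2)[OF f] L2D(2)[OF g] by simp
    have "norm (f y * g y) \<le> (norm (f y))\<^sup>2 + (norm (g y))\<^sup>2" for y
    proof -
      have "norm (f y) * norm (g y) \<ge> 0" by simp
      then show ?thesis
        using sum_squares_bound[of "norm (f y)" "norm (g y)"] unfolding norm_mult by linarith
    qed
    then show "AE y in I_meas. norm (f y * g y) \<le> norm ((norm (f y))\<^sup>2 + (norm (g y))\<^sup>2)"
      by (intro AE_I2) simp
  qed (use m in auto)
  show "integrable I_meas (\<lambda>y. norm (f y) * norm (g y))"
    using integrable_norm[OF 1] by (simp add: norm_mult)
qed

text \<open>Integrate 2 s t |f| |g| \<le> s^2 |f|^2 + t^2 |g|^2 and optimise: s = P, t = A gives A
  P^2 \<le> A (A B). If A = 0, a large s contradicts P > 0 instead.\<close>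

lemma L2_Cauchy_Schwarz_norm:
  assumes f: "f \<in> L2" and g: "g \<in> L2"
  shows "(LINT y|I_meas. norm (f y) * norm (g y)) \<le> L2_norm f * L2_norm g"
proof -
  define A B P where "A = (L2_norm f)\<^sup>2" and "B = (L2_norm g)\<^sup>2"
    and "P = (LINT y|I_meas. norm (f y) * norm (g y))"
  have i: "integrable I_meas (\<lambda>y. (norm (f y))\<^sup>2)" "integrable I_meas (\<lambda>y. (norm (g y))\<^sup>2)"
    "integrable I_meas (\<lambda>y. norm (f y) * norm (g y))"
    using f g L2D L2_mult_integrable by auto
  have P0: "0 \<le> P" unfolding P_def by (rule integral_nonneg_AE) simp
  have *: "2 * s * t * P \<le> s\<^sup>2 * A + t\<^sup>2 * B" for s t
  proof -
    have "2 * s * t * P = (LINT y|I_meas. 2 * s * t * (norm (f y) * norm (g y)))"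
      by (simp add: P_def)
    also have "\<dots> \<le> (LINT y|I_meas. s\<^sup>2 * (norm (f y))\<^sup>2 + t\<^sup>2 * (norm (g y))\<^sup>2)"
    proof (rule integral_mono)
      fix y
      show "2 * s * t * (norm (f y) * norm (g y)) \<le> s\<^sup>2 * (norm (f y))\<^sup>2 + t\<^sup>2 * (norm (g y))\<^sup>2"
        using sum_squares_bound[of "s * norm (f y)" "t * norm (g y)"]
        by (simp add: power_mult_distrib mult_ac)
    qed (use i in auto)
    also have "\<dots> = s\<^sup>2 * A + t\<^sup>2 * B"
      using i by (simp add: A_def B_def L2_norm_power2)
    finally show ?thesis .
  qed
  have "P\<^sup>2 \<le> A * B"
  proof (cases "A = 0")
    case True
    have "P = 0"
    proof (rule ccontr)
      assume "P \<noteq> 0"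
      then have "P > 0" using P0 by simp
      have "2 * (B + 1) \<le> B" using *[of "(B+1)/P" 1] True \<open>P > 0\<close> by simp
      moreover have "B \<ge> 0" by (simp add: B_def)
      ultimately show False by simp
    qed
    then show ?thesis by (simp add: A_def B_def)
  next
    case False
    then have "A > 0" by (simp add: A_def)
    have "2 * P * A * P \<le> P\<^sup>2 * A + A\<^sup>2 * B" using *[of P A] by simp
    then have "A * P\<^sup>2 \<le> A * (A * B)" by (simp add: power2_eq_square algebra_simps)
    then show ?thesis using \<open>A > 0\<close> by simp
  qed
  then have "P\<^sup>2 \<le> (L2_norm f * L2_norm g)\<^sup>2" by (simp add: A_def B_def power_mult_distrib)
  then show ?thesis unfolding P_def by (rule power2_le_imp_le) simp
qed

lemma L2_Cauchy_Schwarz: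
  assumes f: "f \<in> L2" and g: "g \<in> L2"
  shows "norm (LINT y|I_meas. f y * g y) \<le> L2_norm f * L2_norm g"
proof -
  have "norm (LINT y|I_meas. f y * g y) \<le> (LINT y|I_meas. norm (f y * g y))"
    by (rule integral_norm_bound)
  also have "\<dots> \<le> L2_norm f * L2_norm g"
    using L2_Cauchy_Schwarz_norm[OF f g] by (simp add: norm_mult)
  finally show ?thesis .
qed

text \<open>Holds for arbitrary f because a non-integrable integrand has integral 0 by default,
  which only lowers the left side.\<close>

lemma L2_norm_mono:
  fixes f g :: "real \<Rightarrow> 'a::real_normed_vector"
  assumes "integrable I_meas (\<lambda>y. (norm (g y))\<^sup>2)"
    and "\<And>y. y \<in> I_dom \<Longrightarrow> norm (f y) \<le> norm (g y)"
  shows "L2_norm f \<le> L2_norm g"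
  unfolding L2_norm_def
proof (rule real_sqrt_le_mono)
  show "(LINT y|I_meas. (norm (f y))\<^sup>2) \<le> (LINT y|I_meas. (norm (g y))\<^sup>2)"
    by (rule Bochner_Integration.integral_mono') (use assms in \<open>auto intro: power_mono\<close>)
qed

lemma L2_norm_cong_AE:
  assumes "f \<in> L2" "g \<in> L2" "AE y in I_meas. f y = g y"
  shows "L2_norm f = L2_norm g"
proof -
  have "(LINT y|I_meas. (norm (f y))\<^sup>2) = (LINT y|I_meas. (norm (g y))\<^sup>2)"
    by (rule integral_cong_AE) (use assms L2D in auto)
  then show ?thesis by (simp add: L2_norm_def)
qed

lemma L2_norm_cong:
  assumes "\<And>y. y \<in> I_dom \<Longrightarrow> norm (f y) = norm (g y)"
  shows "L2_norm f = L2_norm g"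
  unfolding L2_norm_def by (intro arg_cong[where f=sqrt] Bochner_Integration.integral_cong) (use assms in auto)

lemma L2_norm_cmult: "L2_norm (\<lambda>y. c * f y) = norm c * L2_norm f" for c :: complex
proof -
  have "L2_norm (\<lambda>y. c * f y) = sqrt ((norm c)\<^sup>2 * (LINT y|I_meas. (norm (f y))\<^sup>2))"
    unfolding L2_norm_def by (simp add: norm_mult power_mult_distrib)
  then show ?thesis by (simp add: real_sqrt_mult L2_norm_def)
qed

lemma L2_norm_cnj: "L2_norm (\<lambda>y. cnj (f y)) = L2_norm f"
  by (rule L2_norm_cong) simp

lemma L2_norm_bounded_mult:
  assumes f: "f \<in> L2" and "0 \<le> B" and B: "\<And>y. y \<in> I_dom \<Longrightarrow> norm (a y) \<le> B"
  shows "L2_norm (\<lambda>y. a y * f y) \<le> B * L2_norm f"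
proof -
  have "L2_norm (\<lambda>y. a y * f y) \<le> L2_norm (\<lambda>y. of_real B * f y)"
  proof (rule L2_norm_mono)
    show "integrable I_meas (\<lambda>y. (norm (of_real B * f y))\<^sup>2)"
      using L2D(2)[OF L2_cmult[OF f]] .
    show "norm (a y * f y) \<le> norm (of_real B * f y)" if "y \<in> I_dom" for y
      using B[OF that] \<open>0 \<le> B\<close> by (simp add: norm_mult mult_right_mono)
  qed
  then show ?thesis using \<open>0 \<le> B\<close> by (simp add: L2_norm_cmult)
qed

lemma L2_norm_triangle:
  assumes f: "f \<in> L2" and g: "g \<in> L2"
  shows "L2_norm (\<lambda>y. f y + g y) \<le> L2_norm f + L2_norm g"
proof -
  have i: "integrable I_meas (\<lambda>y. (norm (f y))\<^sup>2)" "integrable I_meas (\<lambda>y. (norm (g y))\<^sup>2)"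
    "integrable I_meas (\<lambda>y. norm (f y) * norm (g y))"
    using f g L2D L2_mult_integrable by auto
  have "(L2_norm (\<lambda>y. f y + g y))\<^sup>2
      \<le> (LINT y|I_meas. (norm (f y))\<^sup>2 + (norm (g y))\<^sup>2 + 2 * (norm (f y) * norm (g y)))"
    unfolding L2_norm_power2
  proof (rule integral_mono)
    show "integrable I_meas (\<lambda>y. (norm (f y + g y))\<^sup>2)" using L2D(2)[OF L2_add[OF f g]] .
    fix y
    have "(norm (f y + g y))\<^sup>2 \<le> (norm (f y) + norm (g y))\<^sup>2"
      by (intro power_mono norm_triangle_ineq) auto
    then show "(norm (f y + g y))\<^sup>2 \<le> (norm (f y))\<^sup>2 + (norm (g y))\<^sup>2 + 2 * (norm (f y) * norm (g y))"
      by (simp add: power2_sum)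
  qed (use i in auto)
  also have "\<dots> = (L2_norm f)\<^sup>2 + (L2_norm g)\<^sup>2 + 2 * (LINT y|I_meas. norm (f y) * norm (g y))"
    using i by (simp add: L2_norm_power2)
  also have "\<dots> \<le> (L2_norm f + L2_norm g)\<^sup>2"
    using L2_Cauchy_Schwarz_norm[OF f g] by (simp add: power2_sum)
  finally show ?thesis by (rule power2_le_imp_le) simp
qed

lemma L2_norm_triangle_diff:
  assumes "f \<in> L2" "g \<in> L2"
  shows "L2_norm f \<le> L2_norm (\<lambda>y. f y - g y) + L2_norm g"
  using L2_norm_triangle[OF L2_diff[OF assms] assms(2)] by simp

lemma L2_norm_minus_commute: "L2_norm (\<lambda>y. f y - g y) = L2_norm (\<lambda>y. g y - f y)"
  by (rule L2_norm_cong) (rule norm_minus_commute)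

lemma L2_bounded:
  fixes f :: "real \<Rightarrow> complex"
  assumes "f \<in> borel_measurable I_meas" "\<And>y. y \<in> I_dom \<Longrightarrow> norm (f y) \<le> B"
  shows "f \<in> L2"
proof -
  have "emeasure lebesgue I_dom = 2" by simp
  then have "integrable I_meas (\<lambda>y. 1::real)"
    by (intro finite_measure.integrable_const finite_measureI) (simp add: emeasure_restrict_space)
  then have "(\<lambda>y. 1) \<in> L2" by (intro L2I) auto
  from L2_bounded_mult[OF this assms] show ?thesis by simp
qed

lemma continuous_measurable_I:
  fixes f :: "real \<Rightarrow> 'a::{euclidean_space}"
  shows "continuous_on I_dom f \<Longrightarrow> f \<in> borel_measurable I_meas"
  by (rule continuous_imp_measurable_on_sets_lebesgue) auto

lemma L2_continuous:
  assumes "continuous_on {-1..1} f"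
  shows "f \<in> L2"
proof -
  have "bounded (f ` {-1..1})"
    using assms by (intro compact_imp_bounded compact_continuous_image) auto
  then obtain B where "\<And>y. y \<in> {-1..1} \<Longrightarrow> norm (f y) \<le> B"
    unfolding bounded_iff by blast
  then show ?thesis
    by (intro L2_bounded[where B=B] continuous_measurable_I continuous_on_subset[OF assms]) auto
qed

lemma L2_const [simp]: "(\<lambda>y. c) \<in> L2"
  by (rule L2_continuous) simp

lemma L2_norm_1: "L2_norm (\<lambda>y. 1::complex) = sqrt 2"
  by (simp add: L2_norm_def measure_restrict_space)

lemma L2_integrable:
  assumes "f \<in> L2" shows "integrable I_meas f"
  using L2_mult_integrable(1)[OF assms L2_const[of 1]] by simp

lemma L2_norm_bounded:
  fixes f :: "real \<Rightarrow> complex"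
  assumes "0 \<le> B" "\<And>y. y \<in> I_dom \<Longrightarrow> norm (f y) \<le> B"
  shows "L2_norm f \<le> B * sqrt 2"
  using L2_norm_bounded_mult[of "\<lambda>y. 1" B f] assms by (simp add: L2_norm_1)

section \<open>Convergence in L2\<close>

text \<open>Membership is built in because a function whose square is not integrable has
  \<open>L2_norm\<close> 0, so a small norm alone says nothing.\<close>

definition L2_lim :: "(nat \<Rightarrow> real \<Rightarrow> complex) \<Rightarrow> (real \<Rightarrow> complex) \<Rightarrow> bool" where
  "L2_lim s f \<longleftrightarrow> (\<forall>n. s n \<in> L2) \<and> f \<in> L2 \<and> (\<lambda>n. L2_norm (\<lambda>y. s n y - f y)) \<longlonglongrightarrow> 0"

lemma L2_limD: "L2_lim s f \<Longrightarrow> s n \<in> L2" "L2_lim s f \<Longrightarrow> f \<in> L2"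
  by (auto simp: L2_lim_def)

lemma L2_limI_le:
  assumes "\<And>n. s n \<in> L2" "f \<in> L2" "\<And>n. L2_norm (\<lambda>y. s n y - f y) \<le> a n" "a \<longlonglongrightarrow> 0"
  shows "L2_lim s f"
  unfolding L2_lim_def
proof (intro conjI allI)
  show "(\<lambda>n. L2_norm (\<lambda>y. s n y - f y)) \<longlonglongrightarrow> 0"
    by (rule tendsto_sandwich[OF _ _ tendsto_const assms(4)]) (auto intro: always_eventually assms(3))
qed (use assms in auto)

text \<open>Domination is asked of the differences, the form in which the cutoffs and truncations
  below supply it.\<close>

lemma L2_lim_dominated:
  assumes s: "\<And>n. s n \<in> L2" and f: "f \<in> L2" and g: "g \<in> L2"
    and conv: "AE y in I_meas. (\<lambda>n. s n y) \<longlonglongrightarrow> f y"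
    and bd: "\<And>n. AE y in I_meas. norm (s n y - f y) \<le> norm (g y)"
  shows "L2_lim s f"
proof -
  have "(\<lambda>n. LINT y|I_meas. (norm (s n y - f y))\<^sup>2) \<longlonglongrightarrow> (LINT y|I_meas. (0::real))"
  proof (rule integral_dominated_convergence)
    show "(\<lambda>y. 0::real) \<in> borel_measurable I_meas" by simp
    show "(\<lambda>y. (norm (s n y - f y))\<^sup>2) \<in> borel_measurable I_meas" for n
      using L2D(2)[OF L2_diff[OF s f]] by (rule borel_measurable_integrable)
    show "integrable I_meas (\<lambda>y. (norm (g y))\<^sup>2)" using L2D(2)[OF g] .
    show "AE y in I_meas. (\<lambda>n. (norm (s n y - f y))\<^sup>2) \<longlonglongrightarrow> 0"
      using conv
    proof eventually_elim
      case (elim y)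
      have "(\<lambda>n. (norm (s n y - f y))\<^sup>2) \<longlonglongrightarrow> (norm (f y - f y))\<^sup>2"
        by (intro tendsto_intros elim)
      then show ?case by simp
    qed
    show "AE y in I_meas. norm ((norm (s n y - f y))\<^sup>2) \<le> (norm (g y))\<^sup>2" for n
      using bd[of n] by eventually_elim (simp add: power_mono)
  qed
  then have "(\<lambda>n. sqrt (LINT y|I_meas. (norm (s n y - f y))\<^sup>2)) \<longlonglongrightarrow> sqrt 0"
    by (intro tendsto_intros) simp
  then show ?thesis using s f by (simp add: L2_lim_def L2_norm_def)
qed

lemma L2_lim_norm:
  assumes "L2_lim s f"
  shows "(\<lambda>n. L2_norm (s n)) \<longlonglongrightarrow> L2_norm f"
proof -
  have "norm (L2_norm (s n) - L2_norm f) \<le> L2_norm (\<lambda>y. s n y - f y)" for n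
    using L2_norm_triangle_diff[OF L2_limD(1)[OF assms, of n] L2_limD(2)[OF assms]]
      L2_norm_triangle_diff[OF L2_limD(2)[OF assms] L2_limD(1)[OF assms, of n]]
      L2_norm_minus_commute[of "s n" f] unfolding real_norm_def by linarith
  moreover have "(\<lambda>n. L2_norm (\<lambda>y. s n y - f y)) \<longlonglongrightarrow> 0"
    using assms by (simp add: L2_lim_def)
  ultimately have "(\<lambda>n. L2_norm (s n) - L2_norm f) \<longlonglongrightarrow> 0"
    by (rule Lim_null_comparison[OF always_eventually[OF allI]])
  then show ?thesis by (rule LIM_zero_cancel)
qed

lemma L2_lim_integral:
  assumes s: "L2_lim s f" and g: "g \<in> L2"
  shows "(\<lambda>n. LINT y|I_meas. g y * s n y) \<longlonglongrightarrow> (LINT y|I_meas. g y * f y)"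
proof -
  note L = L2_limD(1)[OF s] L2_limD(2)[OF s]
  have "norm ((LINT y|I_meas. g y * s n y) - (LINT y|I_meas. g y * f y))
      \<le> L2_norm g * L2_norm (\<lambda>y. s n y - f y)" for n
    using L2_Cauchy_Schwarz[OF g L2_diff[OF L(1)[of n] L(2)]]
      L2_mult_integrable(1)[OF g L(1)[of n]] L2_mult_integrable(1)[OF g L(2)]
    by (simp add: right_diff_distrib)
  moreover have "(\<lambda>n. L2_norm g * L2_norm (\<lambda>y. s n y - f y)) \<longlonglongrightarrow> 0"
    using s unfolding L2_lim_def by (intro tendsto_mult_right_zero) auto
  ultimately have "(\<lambda>n. (LINT y|I_meas. g y * s n y) - (LINT y|I_meas. g y * f y)) \<longlonglongrightarrow> 0"
    by (rule Lim_null_comparison[OF always_eventually[OF allI]])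
  then show ?thesis by (rule LIM_zero_cancel)
qed

lemma L2_lim_add:
  assumes s: "L2_lim s f" and t: "L2_lim t g"
  shows "L2_lim (\<lambda>n y. s n y + t n y) (\<lambda>y. f y + g y)"
proof (rule L2_limI_le)
  show "(\<lambda>n. L2_norm (\<lambda>y. s n y - f y) + L2_norm (\<lambda>y. t n y - g y)) \<longlonglongrightarrow> 0"
    using s t unfolding L2_lim_def by (auto intro: tendsto_add_zero)
  show "L2_norm (\<lambda>y. s n y + t n y - (f y + g y))
    \<le> L2_norm (\<lambda>y. s n y - f y) + L2_norm (\<lambda>y. t n y - g y)" for n
    using L2_norm_triangle[of "\<lambda>y. s n y - f y" "\<lambda>y. t n y - g y"] L2_limD[OF s] L2_limD[OF t]
    by (simp add: L2_diff algebra_simps)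
qed (use L2_limD[OF s] L2_limD[OF t] in \<open>auto intro: L2_add\<close>)

lemma L2_lim_mult:
  assumes s: "L2_lim s f" and a: "a \<in> borel_measurable I_meas"
    and B: "\<And>y. y \<in> I_dom \<Longrightarrow> norm (a y) \<le> B" "0 \<le> B"
  shows "L2_lim (\<lambda>n y. a y * s n y) (\<lambda>y. a y * f y)"
proof (rule L2_limI_le)
  show "(\<lambda>n. B * L2_norm (\<lambda>y. s n y - f y)) \<longlonglongrightarrow> 0"
    using s unfolding L2_lim_def by (auto intro: tendsto_mult_right_zero)
  show "L2_norm (\<lambda>y. a y * s n y - a y * f y) \<le> B * L2_norm (\<lambda>y. s n y - f y)" for n
    using L2_norm_bounded_mult[OF L2_diff[OF L2_limD(1)[OF s, of n] L2_limD(2)[OF s]] B(2,1)]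
    by (simp add: right_diff_distrib)
qed (use L2_limD[OF s] L2_bounded_mult[OF _ a B(1)] in blast)+

lemma L2_lim_cnj:
  assumes s: "L2_lim s f"
  shows "L2_lim (\<lambda>n y. cnj (s n y)) (\<lambda>y. cnj (f y))"
proof -
  have "L2_norm (\<lambda>y. cnj (s n y) - cnj (f y)) = L2_norm (\<lambda>y. s n y - f y)" for n
    using L2_norm_cnj[of "\<lambda>y. s n y - f y"] by simp
  then show ?thesis using s by (auto simp: L2_lim_def intro: L2_cnj)
qed

section \<open>Smooth functions\<close>

text \<open>Iterating \<open>vderiv\<close> from the outside gives no induction for products or
  inverses. Here the first derivative is peeled off instead, so that closure properties follow by
  induction on the order with the functions generalised.\<close>

fun diff_upto :: "nat \<Rightarrow> (real \<Rightarrow> complex) \<Rightarrow> bool" where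
  "diff_upto 0 f \<longleftrightarrow> (\<forall>y. f differentiable at y)"
| "diff_upto (Suc n) f \<longleftrightarrow> (\<forall>y. f differentiable at y) \<and> diff_upto n (vderiv f)"

definition smooth :: "(real \<Rightarrow> complex) \<Rightarrow> bool" where
  "smooth f \<longleftrightarrow> (\<forall>n y. (vderiv ^^ n) f differentiable at y)"

lemma diff_upto_iff: "diff_upto n f \<longleftrightarrow> (\<forall>j\<le>n. \<forall>y. (vderiv ^^ j) f differentiable at y)"
proof (induction n arbitrary: f)
  case (Suc n)
  have "(\<forall>j\<le>Suc n. P j) \<longleftrightarrow> P 0 \<and> (\<forall>j\<le>n. P (Suc j))" for P :: "nat \<Rightarrow> bool"
    by (metis Suc_le_mono le0 not0_implies_Suc)
  from this[of "\<lambda>j. \<forall>y. (vderiv ^^ j) f differentiable at y"] show ?case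
    by (simp add: Suc.IH funpow_Suc_right del: funpow.simps(2))
qed simp

lemma smooth_iff_diff_upto: "smooth f \<longleftrightarrow> (\<forall>n. diff_upto n f)"
  unfolding smooth_def diff_upto_iff by blast

lemma vderiv_eq: "(\<And>y. (f has_vector_derivative f' y) (at y)) \<Longrightarrow> vderiv f = f'"
  unfolding vderiv_def by (auto intro: vector_derivative_at)

lemma diff_upto_vderiv: "diff_upto n f \<Longrightarrow> (f has_vector_derivative vderiv f y) (at y)"
  by (cases n) (auto simp: vderiv_def vector_derivative_works[symmetric])

lemma diff_upto_SucI:
  assumes "\<And>y. (f has_vector_derivative f' y) (at y)" "diff_upto n f'"
  shows "diff_upto (Suc n) f"
  using assms vderiv_eq[OF assms(1)] by (auto intro: differentiableI_vector)

lemma diff_upto_0I: "(\<And>y. (f has_vector_derivative f' y) (at y)) \<Longrightarrow> diff_upto 0 f"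
  by (auto intro: differentiableI_vector)

lemma diff_upto_Suc_imp: "diff_upto (Suc n) f \<Longrightarrow> diff_upto n f"
  by (induction n arbitrary: f) auto

lemma diff_upto_add: "diff_upto n f \<Longrightarrow> diff_upto n g \<Longrightarrow> diff_upto n (\<lambda>y. f y + g y)"
proof (induction n arbitrary: f g)
  case 0
  then show ?case by (auto intro: differentiable_add)
next
  case (Suc n)
  show ?case
    by (rule diff_upto_SucI[OF has_vector_derivative_add[OF diff_upto_vderiv diff_upto_vderiv], OF Suc.prems])
      (use Suc in auto)
qed

lemma diff_upto_mult: "diff_upto n f \<Longrightarrow> diff_upto n g \<Longrightarrow> diff_upto n (\<lambda>y. f y * g y)"
proof (induction n arbitrary: f g)
  case 0
  then show ?case by (auto intro: differentiable_mult)
next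
  case (Suc n)
  show ?case
    by (rule diff_upto_SucI[OF has_vector_derivative_mult[OF diff_upto_vderiv diff_upto_vderiv], OF Suc.prems])
      (use Suc diff_upto_Suc_imp[OF Suc.prems(1)] diff_upto_Suc_imp[OF Suc.prems(2)]
        in \<open>auto intro!: diff_upto_add\<close>)
qed

lemma diff_upto_cnj: "diff_upto n f \<Longrightarrow> diff_upto n (\<lambda>y. cnj (f y))"
proof (induction n arbitrary: f)
  case 0
  show ?case
    by (rule diff_upto_0I, rule has_vector_derivative_cnj, rule diff_upto_vderiv, rule 0)
next
  case (Suc n)
  show ?case
    by (rule diff_upto_SucI[OF has_vector_derivative_cnj[OF diff_upto_vderiv], OF Suc.prems])
      (use Suc in auto)
qed

lemma diff_upto_const: "diff_upto n (\<lambda>y. c)"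
proof (induction n arbitrary: c)
  case 0
  show ?case by simp
next
  case (Suc n)
  show ?case by (rule diff_upto_SucI[OF has_vector_derivative_const]) (rule Suc.IH)
qed

text \<open>The derivative is - g' (1/g) (1/g), a product of functions already known to be
  differentiable to order n, so the induction needs no other g.\<close>

lemma diff_upto_inverse:
  assumes "\<And>y. g y \<noteq> 0"
  shows "diff_upto n g \<Longrightarrow> diff_upto n (\<lambda>y. inverse (g y))"
proof (induction n)
  case 0
  then show ?case using assms by (auto intro: differentiable_inverse)
next
  case (Suc n)
  have d: "((\<lambda>y. inverse (g y)) has_vector_derivative (- 1) * (vderiv g y * (inverse (g y) * inverse (g y)))) (at y)" for y
  proof -
    have "(g has_derivative (\<lambda>x. x *\<^sub>R vderiv g y)) (at y)"
      using diff_upto_vderiv[OF Suc.prems, of y] by (simp add: has_vector_derivative_def)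
    from Deriv.has_derivative_inverse[OF assms this] show ?thesis
      by (simp add: has_vector_derivative_def mult_ac)
  qed
  show ?case
    using Suc diff_upto_Suc_imp[OF Suc.prems]
    by (intro diff_upto_SucI[OF d] diff_upto_mult diff_upto_const) auto
qed

lemma smoothI:
  assumes "\<And>y. (f has_vector_derivative f' y) (at y)" "smooth f'"
  shows "smooth f"
  unfolding smooth_iff_diff_upto
proof
  fix n
  from assms show "diff_upto n f"
    by (cases n) (auto simp: smooth_iff_diff_upto simp del: diff_upto.simps intro: diff_upto_SucI diff_upto_0I)
qed

lemma smooth_has_vderiv: "smooth f \<Longrightarrow> (f has_vector_derivative vderiv f y) (at y)"
  by (auto simp: smooth_iff_diff_upto intro: diff_upto_vderiv)

lemma smooth_vderiv: "smooth f \<Longrightarrow> smooth (vderiv f)"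
  unfolding smooth_iff_diff_upto by (metis diff_upto.simps(2))

lemma smooth_add: "smooth f \<Longrightarrow> smooth g \<Longrightarrow> smooth (\<lambda>y. f y + g y)"
  by (auto simp: smooth_iff_diff_upto intro: diff_upto_add)

lemma smooth_mult: "smooth f \<Longrightarrow> smooth g \<Longrightarrow> smooth (\<lambda>y. f y * g y)"
  by (auto simp: smooth_iff_diff_upto intro: diff_upto_mult)

lemma smooth_cnj: "smooth f \<Longrightarrow> smooth (\<lambda>y. cnj (f y))"
  by (auto simp: smooth_iff_diff_upto intro: diff_upto_cnj)

lemma smooth_const [simp]: "smooth (\<lambda>y. c)"
  by (auto simp: smooth_iff_diff_upto intro: diff_upto_const)

lemma smooth_inverse: "(\<And>y. g y \<noteq> 0) \<Longrightarrow> smooth g \<Longrightarrow> smooth (\<lambda>y. inverse (g y))"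
  by (auto simp: smooth_iff_diff_upto intro: diff_upto_inverse)

lemma smooth_of_real [simp]: "smooth of_real"
  by (rule smoothI[of _ "\<lambda>y. 1"]) (auto intro!: has_vector_derivative_of_real derivative_eq_intros)

lemma smooth_continuous_on: "smooth f \<Longrightarrow> continuous_on S f"
  by (meson smooth_has_vderiv has_vector_derivative_continuous continuous_at_imp_continuous_on)

lemma smooth_polynomial_function:
  fixes p :: "real \<Rightarrow> complex"
  assumes "polynomial_function p"
  shows "smooth p"
proof -
  have "diff_upto n p" if "polynomial_function p" for n and p :: "real \<Rightarrow> complex"
    using that
  proof (induction n arbitrary: p)
    case 0
    then show ?case by (metis has_vector_derivative_polynomial_function diff_upto_0I)
  next
    case (Suc n)
    then show ?case by (metis has_vector_derivative_polynomial_function diff_upto_SucI)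
  qed
  then show ?thesis using assms by (simp add: smooth_iff_diff_upto)
qed

text \<open>The family of all \<open>flat P\<close> is closed under differentiation, which gives smoothness at \<open>0\<close>.\<close>

definition flat :: "real poly \<Rightarrow> real \<Rightarrow> real" where
  "flat P x = (if x > 0 then poly P (1/x) * exp (- 1/x) else 0)"

text \<open>With z = 1 / x one has dz/dx = - z^2, so P(z) exp(-z) has derivative z^2 (P - P')(z)
  exp(-z). At 0 the right difference quotient is z P(z) exp(-z) with z tending to infinity, hence
  tends to 0.\<close>

lemma flat_deriv:
  "(flat P has_real_derivative flat ([:0,0,1:] * (P - pderiv P)) x) (at x)"
proof (cases "x > 0")
  case True
  have "((\<lambda>x. poly P (1/x) * exp (- 1/x)) has_real_derivative flat ([:0,0,1:] * (P - pderiv P)) x) (at x)"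
    using True
    by (auto intro!: derivative_eq_intros simp: flat_def field_simps power2_eq_square)
  then show ?thesis
    by (rule has_field_derivative_transform_within_open[where S="{0<..}"]) (use True in \<open>auto simp: flat_def\<close>)
next
  case False
  show ?thesis
  proof (cases "x < 0")
    case True
    have "((\<lambda>x. 0) has_real_derivative flat ([:0,0,1:] * (P - pderiv P)) x) (at x)"
      using True by (simp add: flat_def)
    then show ?thesis
      by (rule has_field_derivative_transform_within_open[where S="{..<0}"]) (use True in \<open>auto simp: flat_def\<close>)
  next
    case False
    with \<open>\<not> x > 0\<close> have x: "x = 0" by simp
    have lim: "((\<lambda>z. poly P z / exp z) \<longlongrightarrow> 0) at_top" for P :: "real poly"
    proof -
      have "((\<lambda>z. \<Sum>i\<le>degree P. coeff P i * (z ^ i / exp z)) \<longlongrightarrow> (\<Sum>i\<le>degree P. coeff P i * 0)) at_top"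
        by (intro tendsto_intros tendsto_power_div_exp_0)
      then show ?thesis by (simp add: poly_altdef sum_divide_distrib)
    qed
    have "((\<lambda>y. (flat P y - flat P 0) / (y - 0)) \<longlongrightarrow> 0) (at 0)"
    proof (rule filterlim_split_at)
      have "\<forall>\<^sub>F y in at_left (0::real). (flat P y - flat P 0) / (y - 0) = 0"
        by (auto simp: eventually_at_filter flat_def intro!: always_eventually)
      then show "((\<lambda>y. (flat P y - flat P 0) / (y - 0)) \<longlongrightarrow> 0) (at_left 0)"
        by (rule tendsto_eventually)
      have "((\<lambda>y. poly ([:0,1:] * P) (inverse y) / exp (inverse y)) \<longlongrightarrow> 0) (at_right (0::real))"
        by (rule filterlim_compose[OF lim filterlim_inverse_at_top_right])
      moreover have "\<forall>\<^sub>F y in at_right (0::real). poly ([:0,1:] * P) (inverse y) / exp (inverse y) = (flat P y - flat P 0) / (y - 0)"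
        by (auto simp: eventually_at_filter flat_def exp_minus field_simps intro!: always_eventually)
      ultimately show "((\<lambda>y. (flat P y - flat P 0) / (y - 0)) \<longlongrightarrow> 0) (at_right 0)"
        by (rule Lim_transform_eventually)
    qed
    then show ?thesis
      by (simp add: has_field_derivative_iff x flat_def)
  qed
qed

text \<open>By the chain rule differentiation changes P and adds the smooth factor - 2 b y, so the
  induction on the order runs over all P at once.\<close>

lemma smooth_flat_quadratic: "smooth (\<lambda>y. of_real (flat P (a - b * y\<^sup>2)))"
proof -
  have "diff_upto n (\<lambda>y. of_real (flat P (a - b * y\<^sup>2)))" for n
  proof (induction n arbitrary: P)
    let ?Q = "\<lambda>P. [:0,0,1:] * (P - pderiv P)"
    have d: "((\<lambda>y. complex_of_real (flat P (a - b * y\<^sup>2))) has_vector_derivative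
        of_real (flat (?Q P) (a - b * y\<^sup>2)) * (of_real (- 2 * b) * of_real y)) (at y)" for P y
    proof -
      have "((\<lambda>y. flat P (a - b * y\<^sup>2)) has_real_derivative flat (?Q P) (a - b * y\<^sup>2) * (- 2 * b * y)) (at y)"
        by (rule DERIV_chain2[OF flat_deriv]) (auto intro!: derivative_eq_intros)
      from has_vector_derivative_of_real[OF this]
      show ?thesis by simp
    qed
    case 0
    show ?case by (rule diff_upto_0I[OF d])
    case (Suc n)
    have "diff_upto n of_real" using smooth_of_real by (simp add: smooth_iff_diff_upto)
    then show ?case
      by (intro diff_upto_SucI[OF d] diff_upto_mult diff_upto_const Suc.IH)
  qed
  then show ?thesis by (simp add: smooth_iff_diff_upto)
qed

section \<open>Density of the test functions\<close>

text \<open>A compact subset of the open interval stays away from both end points. A single radius r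
  is easier to combine than compact supports: sums take the maximum.\<close>

lemma test_fun_iff:
  "\<psi> \<in> test_fun \<longleftrightarrow> smooth \<psi> \<and> (\<exists>r. 0 \<le> r \<and> r < 1 \<and> (\<forall>y. r < \<bar>y\<bar> \<longrightarrow> \<psi> y = 0))"
proof -
  have "(\<exists>K. compact K \<and> K \<subseteq> I_dom \<and> (\<forall>y. y \<notin> K \<longrightarrow> \<psi> y = 0)) \<longleftrightarrow>
    (\<exists>r. 0 \<le> r \<and> r < 1 \<and> (\<forall>y. r < \<bar>y\<bar> \<longrightarrow> \<psi> y = 0))" (is "?L \<longleftrightarrow> ?R")
  proof
    assume ?L
    then obtain K where K: "compact K" "K \<subseteq> I_dom" "\<And>y. y \<notin> K \<Longrightarrow> \<psi> y = 0" by blast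
    show ?R
    proof (cases "K = {}")
      case True
      then show ?thesis using K(3) by (intro exI[of _ 0]) auto
    next
      case False
      have "continuous_on K (\<lambda>y. \<bar>y\<bar>)" by (intro continuous_intros)
      then obtain x where x: "x \<in> K" "\<And>y. y \<in> K \<Longrightarrow> \<bar>y\<bar> \<le> \<bar>x\<bar>"
        using continuous_attains_sup[OF K(1) False] by blast
      have "\<bar>x\<bar> < 1" using subsetD[OF K(2) x(1)] by (simp add: abs_less_iff)
      moreover have "\<psi> y = 0" if "\<bar>x\<bar> < \<bar>y\<bar>" for y
        using that x(2)[of y] K(3)[of y] by linarith
      ultimately show ?thesis by (intro exI[of _ "\<bar>x\<bar>"]) auto
    qed
  next
    assume ?R
    then obtain r where r: "0 \<le> r" "r < 1" "\<And>y. r < \<bar>y\<bar> \<Longrightarrow> \<psi> y = 0" by blast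
    have "\<psi> y = 0" if "y \<notin> {-r..r}" for y using that by (intro r(3)) auto
    then show ?L using r(2) by (intro exI[of _ "{-r..r}"]) auto
  qed
  then show ?thesis by (auto simp: test_fun_def smooth_def)
qed

lemma test_funE:
  assumes "\<psi> \<in> test_fun"
  obtains r where "0 \<le> r" "r < 1" "\<And>y. r < \<bar>y\<bar> \<Longrightarrow> \<psi> y = 0"
  using assms unfolding test_fun_iff by blast

lemma test_fun_smooth: "\<psi> \<in> test_fun \<Longrightarrow> smooth \<psi>"
  by (simp add: test_fun_iff)

lemma test_fun_zero: "\<psi> \<in> test_fun \<Longrightarrow> 1 \<le> \<bar>y\<bar> \<Longrightarrow> \<psi> y = 0"
  by (erule test_funE) auto

lemma test_fun_vderiv:
  assumes "\<psi> \<in> test_fun"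
  shows "vderiv \<psi> \<in> test_fun"
proof -
  obtain r where r: "0 \<le> r" "r < 1" "\<And>y. r < \<bar>y\<bar> \<Longrightarrow> \<psi> y = 0" using test_funE[OF assms] by blast
  have "vderiv \<psi> y = 0" if "r < \<bar>y\<bar>" for y
  proof -
    have "((\<lambda>y. 0) has_vector_derivative 0) (at y)" by simp
    moreover have "open {y::real. r < \<bar>y\<bar>}" by (intro open_Collect_less continuous_intros)
    ultimately have "(\<psi> has_vector_derivative 0) (at y)"
      by (rule has_vector_derivative_transform_within_open) (use that r(3) in auto)
    then show ?thesis unfolding vderiv_def by (rule vector_derivative_at)
  qed
  then show ?thesis using r assms by (auto simp: test_fun_iff intro!: smooth_vderiv)
qed

lemma test_fun_mult:
  assumes "\<psi> \<in> test_fun" "smooth a"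
  shows "(\<lambda>y. a y * \<psi> y) \<in> test_fun"
  using assms unfolding test_fun_iff by (auto intro!: smooth_mult)

lemma test_fun_add:
  assumes "\<psi> \<in> test_fun" "\<theta> \<in> test_fun"
  shows "(\<lambda>y. \<psi> y + \<theta> y) \<in> test_fun"
proof -
  obtain r where r: "0 \<le> r" "r < 1" "\<And>y. r < \<bar>y\<bar> \<Longrightarrow> \<psi> y = 0" using test_funE[OF assms(1)] by blast
  obtain r' where r': "0 \<le> r'" "r' < 1" "\<And>y. r' < \<bar>y\<bar> \<Longrightarrow> \<theta> y = 0" using test_funE[OF assms(2)] by blast
  have "\<forall>y. max r r' < \<bar>y\<bar> \<longrightarrow> \<psi> y + \<theta> y = 0" using r(3) r'(3) by simp
  moreover have "0 \<le> max r r'" "max r r' < 1" using r r' by auto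
  ultimately show ?thesis
    unfolding test_fun_iff using assms by (auto intro!: smooth_add simp: test_fun_smooth)
qed

lemma test_fun_cmult: "\<psi> \<in> test_fun \<Longrightarrow> (\<lambda>y. c * \<psi> y) \<in> test_fun"
  by (rule test_fun_mult) auto

lemma test_fun_cnj: "\<psi> \<in> test_fun \<Longrightarrow> (\<lambda>y. cnj (\<psi> y)) \<in> test_fun"
  unfolding test_fun_iff by (auto intro!: smooth_cnj)

lemma test_fun_L2: "\<psi> \<in> test_fun \<Longrightarrow> \<psi> \<in> L2"
  by (intro L2_continuous smooth_continuous_on test_fun_smooth)

lemma vderiv_mult: "smooth f \<Longrightarrow> smooth g \<Longrightarrow> vderiv (\<lambda>y. f y * g y) = (\<lambda>y. f y * vderiv g y + vderiv f y * g y)"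
  by (intro vderiv_eq has_vector_derivative_mult smooth_has_vderiv)

lemma vderiv_cnj: "smooth f \<Longrightarrow> vderiv (\<lambda>y. cnj (f y)) = (\<lambda>y. cnj (vderiv f y))"
  by (intro vderiv_eq has_vector_derivative_cnj smooth_has_vderiv)

lemma vderiv_cmult: "smooth f \<Longrightarrow> vderiv (\<lambda>y. c * f y) = (\<lambda>y. c * vderiv f y)"
  by (intro vderiv_eq has_vector_derivative_mult_right smooth_has_vderiv)

section \<open>Primitives of square-integrable functions\<close>

text \<open>Written as a pairing over all of I with an indicator, so that Cauchy-Schwarz bounds it
  uniformly in x and L2 limits pass through it. The form as an integral over \<open>{-1..x}\<close>
  is recovered in \<open>prim_eq_integral\<close> to get continuity and the fundamental
  theorem.\<close>

definition prim :: "(real \<Rightarrow> complex) \<Rightarrow> real \<Rightarrow> complex" where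
  "prim g x = (LINT y|I_meas. indicator {..x} y * g y)"

lemma indicator_L2: "g \<in> L2 \<Longrightarrow> (\<lambda>y. indicator {..x::real} y * g y) \<in> L2"
proof (rule L2_bounded_mult[where B=1])
  have "indicator {..x} \<in> borel_measurable lborel" by simp
  then have "indicator {..x} \<in> borel_measurable lebesgue" by (rule measurable_completion)
  then show "indicator {..x} \<in> borel_measurable I_meas" by (rule measurable_restrict_space1)
qed (auto simp: indicator_def)

lemma prim_norm_le:
  assumes "g \<in> L2" shows "norm (prim g x) \<le> sqrt 2 * L2_norm g"
proof -
  have "norm (prim g x) \<le> L2_norm (\<lambda>y. 1::complex) * L2_norm (\<lambda>y. indicator {..x} y * g y)"
    unfolding prim_def using L2_Cauchy_Schwarz[OF L2_const[of 1] indicator_L2[OF assms]] by simp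
  also have "\<dots> \<le> sqrt 2 * (1 * L2_norm g)"
    unfolding L2_norm_1 by (intro mult_left_mono L2_norm_bounded_mult assms) (auto simp: indicator_def)
  finally show ?thesis by simp
qed

lemma prim_diff:
  assumes "f \<in> L2" "g \<in> L2" shows "prim (\<lambda>y. f y - g y) x = prim f x - prim g x"
  unfolding prim_def right_diff_distrib
  by (rule Bochner_Integration.integral_diff) (intro L2_integrable indicator_L2 assms)+

lemma prim_eq_integral:
  assumes g: "g \<in> L2" and x: "-1 \<le> x" "x \<le> 1"
  shows "prim g x = integral {-1..x} g"
proof -
  have "prim g x = integral I_dom (\<lambda>y. indicator {..x} y * g y)"
    unfolding prim_def by (rule lebesgue_integral_eq_integral) (auto intro: L2_integrable indicator_L2 g)
  also have "\<dots> = integral {-1..1} (\<lambda>y. indicator {..x} y * g y)"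
    by (rule integral_open_interval_real[symmetric])
  also have "(\<lambda>y. indicator {..x} y * g y) = (\<lambda>y. if y \<in> {..x} then g y else 0)"
    by (auto simp: indicator_def)
  also have "integral {-1..1} \<dots> = integral ({..x} \<inter> {-1..1}) g"
    by (rule integral_restrict_Int)
  also have "{..x} \<inter> {-1..1} = {-1..x}" using x by auto
  finally show ?thesis .
qed

lemma L2_integrable_on:
  assumes "g \<in> L2" shows "g integrable_on {-1..1}"
  using integrable_on_lebesgue_on[OF L2_integrable[OF assms]]
  by (simp add: integrable_on_open_interval_real)

lemma prim_continuous:
  assumes "g \<in> L2" shows "continuous_on {-1..1} (prim g)"
proof -
  have "continuous_on {-1..1} (\<lambda>x. integral {-1..x} g)"
    by (rule indefinite_integral_continuous_1[OF L2_integrable_on[OF assms]])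
  then show ?thesis
    by (rule continuous_on_eq) (use prim_eq_integral[OF assms] in auto)
qed

lemma prim_L2: "g \<in> L2 \<Longrightarrow> prim g \<in> L2"
  by (rule L2_continuous[OF prim_continuous])

lemma prim_minus_1: "g \<in> L2 \<Longrightarrow> prim g (-1) = 0"
  by (simp add: prim_eq_integral)

lemma prim_1: "prim g 1 = (LINT y|I_meas. g y)"
  unfolding prim_def by (rule Bochner_Integration.integral_cong) (auto simp: indicator_def)

lemma prim_vderiv:
  assumes \<psi>: "\<psi> \<in> test_fun" and x: "-1 \<le> x" "x \<le> 1"
  shows "prim (vderiv \<psi>) x = \<psi> x"
proof -
  have "(vderiv \<psi> has_integral (\<psi> x - \<psi> (-1))) {-1..x}"
    by (rule fundamental_theorem_of_calculus)
      (use x in \<open>auto intro: has_vector_derivative_at_within smooth_has_vderiv test_fun_smooth \<psi>\<close>)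
  then show ?thesis
    using test_fun_zero[OF \<psi>, of "-1"] prim_eq_integral[OF test_fun_L2[OF test_fun_vderiv[OF \<psi>]] x]
    by (simp add: integral_unique)
qed

lemma integral_vderiv:
  assumes "\<psi> \<in> test_fun" shows "(LINT y|I_meas. vderiv \<psi> y) = 0"
  using prim_vderiv[OF assms, of 1] test_fun_zero[OF assms, of 1] by (simp add: prim_1)

lemma integral_by_parts:
  assumes \<psi>: "\<psi> \<in> test_fun" and \<theta>: "smooth \<theta>"
  shows "(LINT y|I_meas. \<theta> y * vderiv \<psi> y) = - (LINT y|I_meas. vderiv \<theta> y * \<psi> y)"
proof -
  have t: "(\<lambda>y. \<theta> y * vderiv \<psi> y) \<in> test_fun" "(\<lambda>y. vderiv \<theta> y * \<psi> y) \<in> test_fun" "(\<lambda>y. \<theta> y * \<psi> y) \<in> test_fun"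
    using assms by (auto intro!: test_fun_mult test_fun_vderiv smooth_vderiv)
  have "(LINT y|I_meas. \<theta> y * vderiv \<psi> y + vderiv \<theta> y * \<psi> y) = 0"
    using integral_vderiv[OF t(3)] by (simp add: vderiv_mult[OF \<theta> test_fun_smooth[OF \<psi>]])
  then show ?thesis
    using t by (simp add: test_fun_L2 L2_integrable add_eq_0_iff2)
qed

text \<open>Source of test functions with a prescribed derivative. The primitive from -1 is constant
  on either side of the support of q: it is 0 on the left, and on the right it equals the mean of q,
  so compact support amounts to mean zero.\<close>

lemma smooth_primitive:
  assumes q: "q \<in> test_fun"
  obtains \<psi> where "smooth \<psi>" "vderiv \<psi> = q" "\<And>x. x \<in> {-1..1} \<Longrightarrow> \<psi> x = prim q x"
    "(LINT y|I_meas. q y) = 0 \<Longrightarrow> \<psi> \<in> test_fun"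
proof -
  obtain r where r: "0 \<le> r" "r < 1" "\<And>y. r < \<bar>y\<bar> \<Longrightarrow> q y = 0" using test_funE[OF q] by blast
  define \<psi> where "\<psi> x = integral {-1..x} q" for x
  have io: "q integrable_on {a..b}" for a b
    by (intro integrable_continuous_real smooth_continuous_on test_fun_smooth q)
  have \<psi>_prim: "\<psi> x = prim q x" if "x \<in> {-1..1}" for x
    using prim_eq_integral[OF test_fun_L2[OF q]] that by (simp add: \<psi>_def)
  \<comment> \<open>For x < -1 the interval \<open>{-1..x}\<close> is empty and the integral is 0,
    the value wanted there.\<close>
  have z1: "\<psi> x = 0" if "x < - r" for x
  proof -
    have "\<psi> x = integral {-1..x} (\<lambda>y. 0)"
      unfolding \<psi>_def by (rule integral_cong) (use that r in auto)
    then show ?thesis by simp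
  qed
  have z2: "\<psi> x = \<psi> 1" if "x > r" for x
  proof -
    have z: "integral {a..b} q = 0" if "a > r" for a b
    proof -
      have "integral {a..b} q = integral {a..b} (\<lambda>y. 0)"
        by (rule integral_cong) (use that r in auto)
      then show ?thesis by simp
    qed
    have c: "\<psi> u = \<psi> x" if "r < x" "x \<le> u" for x u
      using Henstock_Kurzweil_Integration.integral_combine[of "-1" x u q] io z[of x u] that r
      unfolding \<psi>_def by simp
    have "r < 1 \<and> 1 \<le> x \<or> x \<le> 1" using r(2) by linarith
    then show ?thesis using c[of 1 x] c[of x 1, OF that, symmetric] by blast
  qed
  have d: "(\<psi> has_vector_derivative q x) (at x)" for x
  proof -
    consider "\<bar>x\<bar> \<le> r" | "x < -r" | "x > r" by linarith
    then show ?thesis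
    proof cases
      case 1
      have "(\<psi> has_vector_derivative q x) (at x within {-1..1})"
        unfolding \<psi>_def by (rule integral_has_vector_derivative)
          (use 1 r in \<open>auto intro: smooth_continuous_on test_fun_smooth q\<close>)
      moreover have "x \<in> interior {-1..1}" using 1 r by auto
      ultimately show ?thesis by (metis at_within_interior)
    next
      case 2
      have "((\<lambda>y. 0) has_vector_derivative (0::complex)) (at x)" by simp
      then have "(\<psi> has_vector_derivative 0) (at x)"
        by (rule has_vector_derivative_transform_within_open[where S="{..<-r}"]) (use 2 z1 in auto)
      then show ?thesis using r(1) r(3)[of x] 2 by simp
    next
      case 3
      have "((\<lambda>y. \<psi> 1) has_vector_derivative 0) (at x)" by simp
      then have "(\<psi> has_vector_derivative 0) (at x)"
        by (rule has_vector_derivative_transform_within_open[where S="{r<..}"]) (use 3 z2 in auto)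
      then show ?thesis using r(1) r(3)[of x] 3 by simp
    qed
  qed
  have sm: "smooth \<psi>" using smoothI[OF d test_fun_smooth[OF q]] .
  moreover have "\<psi> \<in> test_fun" if 0: "(LINT y|I_meas. q y) = 0"
  proof -
    have "\<psi> 1 = 0" using \<psi>_prim[of 1] 0 by (simp add: prim_1)
    then have "\<psi> y = 0" if "r < \<bar>y\<bar>" for y using z1[of y] z2[of y] that by (cases "y > r") auto
    then show ?thesis using r sm unfolding test_fun_iff by blast
  qed
  ultimately show ?thesis using that vderiv_eq[OF d] \<psi>_prim by blast
qed

section \<open>Cutoff functions\<close>

text \<open>The bump exp(-1/x) at x = n (1 - 1/(n+2) - y^2). The inner constant confines the support
  to a radius below 1, while the factor n sends x to infinity, hence the bump to 1, at every |y| <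
  1.\<close>

definition cutoff :: "nat \<Rightarrow> real \<Rightarrow> complex" where
  "cutoff n y = of_real (flat 1 (real n * (1 - 1 / (real n + 2)) - real n * y\<^sup>2))"

lemma cutoff_test_fun: "cutoff n \<in> test_fun"
proof -
  define r where "r = sqrt (1 - 1 / (real n + 2))"
  have r: "0 \<le> r" "r < 1" "r\<^sup>2 = 1 - 1 / (real n + 2)"
    by (auto simp: r_def field_simps)
  have "cutoff n y = 0" if "r < \<bar>y\<bar>" for y
  proof -
    have "r\<^sup>2 \<le> y\<^sup>2" using that r(1) power_mono[of r "\<bar>y\<bar>" 2] by simp
    then have "real n * r\<^sup>2 \<le> real n * y\<^sup>2" by (intro mult_left_mono) auto
    then show ?thesis by (simp add: cutoff_def flat_def r(3))
  qed
  then show ?thesis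
    unfolding test_fun_iff using r smooth_flat_quadratic[of 1 "real n * (1 - 1 / (real n + 2))" "real n"]
    by (auto simp: cutoff_def[abs_def])
qed

lemma flat_1_bounds: "0 \<le> flat 1 x" "flat 1 x \<le> 1"
  by (auto simp: flat_def)

lemma cutoff_norm_le: "norm (cutoff n y) \<le> 1" "norm (cutoff n y - 1) \<le> 1"
proof -
  show "norm (cutoff n y) \<le> 1" unfolding cutoff_def norm_of_real using flat_1_bounds by simp
  have "norm (of_real x - (1::complex)) = \<bar>x - 1\<bar>" for x
    by (metis norm_of_real of_real_1 of_real_diff)
  then show "norm (cutoff n y - 1) \<le> 1" unfolding cutoff_def using flat_1_bounds by simp
qed

lemma cutoff_lim:
  assumes "y \<in> I_dom" shows "(\<lambda>n. cutoff n y) \<longlonglongrightarrow> 1"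
proof -
  have "\<bar>y\<bar> < 1" using assms by auto
  then have y: "y\<^sup>2 < 1" by (simp add: abs_square_less_1)
  have 1: "(\<lambda>n. (1 - 1 / (real n + 2)) - y\<^sup>2) \<longlonglongrightarrow> (1 - 0) - y\<^sup>2"
    by (intro tendsto_intros) real_asymp
  have "filterlim (\<lambda>n. ((1 - 1 / (real n + 2)) - y\<^sup>2) * real n) at_top sequentially"
    by (rule filterlim_tendsto_pos_mult_at_top[OF 1]) (use y in \<open>auto simp: filterlim_real_sequentially\<close>)
  moreover have "(flat 1 \<longlongrightarrow> 1) at_top"
  proof -
    have "((\<lambda>x. exp (- 1 / x)) \<longlongrightarrow> (1::real)) at_top" by real_asymp
    moreover have "\<forall>\<^sub>F x in at_top. exp (- 1 / x) = flat 1 (x::real)"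
      using eventually_gt_at_top[of 0] by eventually_elim (simp add: flat_def)
    ultimately show ?thesis by (rule Lim_transform_eventually)
  qed
  ultimately have "(\<lambda>n. flat 1 (((1 - 1 / (real n + 2)) - y\<^sup>2) * real n)) \<longlonglongrightarrow> 1"
    by (rule filterlim_compose[rotated])
  then have "(\<lambda>n. flat 1 (real n * (1 - 1 / (real n + 2)) - real n * y\<^sup>2)) \<longlonglongrightarrow> 1"
    by (simp add: algebra_simps)
  from tendsto_of_real[OF this, where 'a=complex] show ?thesis by (simp add: cutoff_def)
qed

lemma cutoff_L2_lim:
  assumes f: "f \<in> L2" shows "L2_lim (\<lambda>n y. cutoff n y * f y) f"
proof (rule L2_lim_dominated[OF _ f f])
  show "(\<lambda>y. cutoff n y * f y) \<in> L2" for n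
    by (rule L2_bounded_mult[OF f, where B=1])
      (auto intro: cutoff_norm_le continuous_measurable_I smooth_continuous_on test_fun_smooth cutoff_test_fun)
  show "AE y in I_meas. (\<lambda>n. cutoff n y * f y) \<longlonglongrightarrow> f y"
  proof (rule AE_I2)
    fix y assume "y \<in> space I_meas"
    then have "(\<lambda>n. cutoff n y) \<longlonglongrightarrow> 1" by (intro cutoff_lim) simp
    from tendsto_mult[OF this tendsto_const[of "f y"]] show "(\<lambda>n. cutoff n y * f y) \<longlonglongrightarrow> f y" by simp
  qed
  show "AE y in I_meas. norm (cutoff n y * f y - f y) \<le> norm (f y)" for n
  proof (rule AE_I2)
    fix y
    have "norm ((cutoff n y - 1) * f y) \<le> 1 * norm (f y)"
      unfolding norm_mult by (intro mult_right_mono cutoff_norm_le) auto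
    then show "norm (cutoff n y * f y - f y) \<le> norm (f y)" by (simp add: left_diff_distrib)
  qed
qed

section \<open>The L2 closure of the test functions\<close>

definition test_approx :: "(real \<Rightarrow> complex) \<Rightarrow> bool" where
  "test_approx f \<longleftrightarrow> f \<in> L2 \<and> (\<forall>e>0. \<exists>\<psi>\<in>test_fun. L2_norm (\<lambda>y. \<psi> y - f y) < e)"

lemma test_approx_closed:
  assumes f: "f \<in> L2" and g: "\<And>e. e > 0 \<Longrightarrow> \<exists>g. test_approx g \<and> L2_norm (\<lambda>y. g y - f y) < e"
  shows "test_approx f"
  unfolding test_approx_def
proof (intro conjI f allI impI)
  fix e :: real assume "e > 0"
  then obtain g where g: "test_approx g" "L2_norm (\<lambda>y. g y - f y) < e/2" using g[of "e/2"] by auto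
  then obtain \<psi> where \<psi>: "\<psi> \<in> test_fun" "L2_norm (\<lambda>y. \<psi> y - g y) < e/2"
    unfolding test_approx_def using \<open>e > 0\<close> by (meson half_gt_zero)
  have "g \<in> L2" using g by (simp add: test_approx_def)
  have "L2_norm (\<lambda>y. \<psi> y - f y) \<le> L2_norm (\<lambda>y. \<psi> y - g y) + L2_norm (\<lambda>y. g y - f y)"
    using L2_norm_triangle[of "\<lambda>y. \<psi> y - g y" "\<lambda>y. g y - f y"] \<open>g \<in> L2\<close> f \<psi>(1)
    by (simp add: L2_diff test_fun_L2)
  then show "\<exists>\<psi>\<in>test_fun. L2_norm (\<lambda>y. \<psi> y - f y) < e"
    using g(2) \<psi> by (intro bexI[of _ \<psi>]) auto
qed

lemma test_approx_lim:
  assumes "L2_lim s f" "\<And>n. test_approx (s n)"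
  shows "test_approx f"
proof (rule test_approx_closed)
  show "f \<in> L2" using L2_limD(2)[OF assms(1)] .
  fix e :: real assume "e > 0"
  then have "\<forall>\<^sub>F n in sequentially. L2_norm (\<lambda>y. s n y - f y) < e"
    using assms(1) unfolding L2_lim_def by (auto intro: order_tendstoD)
  then obtain n where "L2_norm (\<lambda>y. s n y - f y) < e" by (auto simp: eventually_sequentially)
  then show "\<exists>g. test_approx g \<and> L2_norm (\<lambda>y. g y - f y) < e" using assms(2) by blast
qed

lemma test_approx_test_fun: "\<psi> \<in> test_fun \<Longrightarrow> test_approx \<psi>"
  unfolding test_approx_def by (auto intro!: test_fun_L2 bexI[of _ \<psi>])

text \<open>Weierstrass gives a polynomial that is uniformly close on [-1,1]; multiplied by the
  cutoffs it becomes a sequence of test functions converging to it in L2.\<close>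

lemma test_approx_continuous:
  assumes f: "continuous_on {-1..1} f"
  shows "test_approx f"
proof (rule test_approx_closed[OF L2_continuous[OF f]])
  fix e :: real assume e: "e > 0"
  obtain p where p: "polynomial_function p" "\<And>y. y \<in> {-1..1} \<Longrightarrow> norm (f y - p y) < e / 2"
    using Stone_Weierstrass_polynomial_function[OF _ f, of "e/2"] e by auto
  have sp: "smooth p" by (rule smooth_polynomial_function[OF p(1)])
  have "test_approx p"
    by (rule test_approx_lim[OF cutoff_L2_lim])
      (auto intro!: L2_continuous smooth_continuous_on sp test_approx_test_fun
        test_fun_mult[OF cutoff_test_fun sp, unfolded mult.commute[of "p _"]])
  moreover have "L2_norm (\<lambda>y. p y - f y) \<le> e/2 * sqrt 2"
    by (rule L2_norm_bounded) (use p(2) e in \<open>auto simp: norm_minus_commute intro: less_imp_le\<close>)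
  \<comment> \<open>The factor \<open>sqrt 2\<close> is the norm of the constant 1 on I; as it is
    below 2, a uniform error of e/2 suffices.\<close>
  moreover have "e/2 * sqrt 2 < e/2 * 2"
    using e sqrt2_less_2 by (intro mult_strict_left_mono) auto
  ultimately show "\<exists>g. test_approx g \<and> L2_norm (\<lambda>y. g y - f y) < e"
    by (intro exI[of _ p]) auto
qed

text \<open>Radial projection onto the closed disc of radius M. Its continuity preserves pointwise
  convergence and its bound provides domination.\<close>

definition clip :: "real \<Rightarrow> complex \<Rightarrow> complex" where
  "clip M z = of_real (M / max M (norm z)) * z"

lemma clip_continuous: "M > 0 \<Longrightarrow> continuous_on UNIV (clip M)"
  unfolding clip_def by (intro continuous_intros) auto

lemma clip_norm: "M > 0 \<Longrightarrow> norm (clip M z) \<le> M" "M > 0 \<Longrightarrow> norm (clip M z - z) \<le> norm z"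
  "M > 0 \<Longrightarrow> norm z \<le> M \<Longrightarrow> clip M z = z"
proof -
  assume M: "M > 0"
  show "norm (clip M z) \<le> M" using M by (auto simp: clip_def norm_mult norm_divide max_def divide_simps)
  show "norm z \<le> M \<Longrightarrow> clip M z = z" using M by (simp add: clip_def max_def)
  have "clip M z - z = of_real (M / max M (norm z) - 1) * z" by (simp add: clip_def left_diff_distrib)
  moreover have "\<bar>M / max M (norm z) - 1\<bar> \<le> 1"
    using M by (auto simp: max_def divide_simps abs_if)
  ultimately show "norm (clip M z - z) \<le> norm z"
    by (metis mult_left_le_one_le norm_ge_zero norm_mult norm_of_real abs_ge_zero)
qed

text \<open>A measurable f is an a.e. limit of continuous functions, but without domination.
  Truncating both sides at a fixed level M makes dominated convergence applicable; afterwards M runs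
  through the positive integers, with f itself as the dominating function.\<close>

lemma test_approx_L2:
  assumes f: "f \<in> L2" shows "test_approx f"
proof -
  have fm: "f measurable_on I_dom" using L2D(1)[OF f] by (subst measurable_on_iff_borel_measurable) auto
  then obtain N g where N: "negligible N" and g: "\<And>n. continuous_on UNIV (g n)"
    "\<And>x. x \<notin> N \<Longrightarrow> (\<lambda>n::nat. g n x) \<longlonglongrightarrow> (if x \<in> I_dom then f x else 0)"
    unfolding measurable_on_def by blast
  have ae: "AE y in I_meas. (\<lambda>n. g n y) \<longlonglongrightarrow> f y"
  proof -
    have "AE y in lebesgue. y \<notin> N"
      using N by (simp add: negligible_iff_null_sets AE_not_in)
    then have "AE y in I_meas. y \<notin> N"
      by (subst AE_restrict_space_iff) auto
    then show ?thesis using AE_space by eventually_elim (use g(2) in force)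
  qed
  have cL2: "(\<lambda>y. clip M (f y)) \<in> L2" if M: "M > 0" for M
    using M by (intro L2_bounded[of _ M] clip_norm borel_measurable_continuous_on[OF clip_continuous L2D(1)[OF f]])
  have c: "test_approx (\<lambda>y. clip M (f y))" if M: "M > 0" for M
  proof (rule test_approx_lim)
    have cc: "continuous_on S (\<lambda>y. clip M (g n y))" for n S
      using continuous_on_compose2[OF clip_continuous[OF M] continuous_on_subset[OF g(1)]] by auto
    show "test_approx (\<lambda>y. clip M (g n y))" for n
      by (rule test_approx_continuous[OF cc])
    show "L2_lim (\<lambda>n y. clip M (g n y)) (\<lambda>y. clip M (f y))"
    proof (rule L2_lim_dominated)
      show "(\<lambda>y. of_real (2 * M)) \<in> L2" by simp
      show "(\<lambda>y. clip M (g n y)) \<in> L2" for n by (rule L2_continuous[OF cc])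
      show "AE y in I_meas. (\<lambda>n. clip M (g n y)) \<longlonglongrightarrow> clip M (f y)"
        using ae by eventually_elim
          (rule continuous_on_tendsto_compose[OF clip_continuous[OF M]], auto)
      show "AE y in I_meas. norm (clip M (g n y) - clip M (f y)) \<le> norm (complex_of_real (2 * M))" for n
      proof (rule AE_I2)
        fix y
        show "norm (clip M (g n y) - clip M (f y)) \<le> norm (complex_of_real (2 * M))"
          using norm_triangle_ineq4[of "clip M (g n y)" "clip M (f y)"] clip_norm(1)[OF M, of "g n y"]
            clip_norm(1)[OF M, of "f y"] M unfolding norm_of_real by linarith
      qed
    qed (rule cL2[OF M])
  qed
  show ?thesis
  proof (rule test_approx_lim)
    show "test_approx (\<lambda>y. clip (Suc n) (f y))" for n by (rule c) simp
    show "L2_lim (\<lambda>n y. clip (Suc n) (f y)) f"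
    proof (rule L2_lim_dominated[OF cL2 f f])
      show "AE y in I_meas. (\<lambda>n. clip (Suc n) (f y)) \<longlonglongrightarrow> f y"
      proof (rule AE_I2)
        fix y
        obtain k :: nat where "norm (f y) \<le> k" using real_arch_simple by blast
        then have "\<forall>\<^sub>F n in sequentially. clip (Suc n) (f y) = f y"
          unfolding eventually_sequentially by (intro exI[of _ k] allI impI clip_norm(3)) auto
        then show "(\<lambda>n. clip (Suc n) (f y)) \<longlonglongrightarrow> f y" by (rule tendsto_eventually)
      qed
      show "AE y in I_meas. norm (clip (Suc n) (f y) - f y) \<le> norm (f y)" for n
        by (rule AE_I2) (rule clip_norm, simp)
    qed simp
  qed
qed

lemma test_fun_dense:
  assumes "f \<in> L2"
  obtains s where "\<And>n. s n \<in> test_fun" "L2_lim s f"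
proof -
  have "\<forall>n. \<exists>\<psi>\<in>test_fun. L2_norm (\<lambda>y. \<psi> y - f y) < inverse (real (Suc n))"
    using test_approx_L2[OF assms] unfolding test_approx_def by (metis inverse_positive_iff_positive of_nat_0_less_iff zero_less_Suc)
  then obtain s where s: "\<And>n. s n \<in> test_fun" "\<And>n. L2_norm (\<lambda>y. s n y - f y) < inverse (real (Suc n))" by metis
  have "L2_lim s f"
    by (rule L2_limI_le[OF _ assms less_imp_le[OF s(2)] LIMSEQ_inverse_real_of_nat]) (rule test_fun_L2[OF s(1)])
  then show ?thesis using that s(1) by blast
qed

section \<open>\<open>H\<^sup>1\<^sub>0(I)\<close> and its dual\<close>

lemma integral_mult_cnj: "(LINT y|I_meas. f y * cnj (f y)) = of_real ((L2_norm f)\<^sup>2)"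
proof -
  have "(LINT y|I_meas. f y * cnj (f y)) = (LINT y|I_meas. complex_of_real ((norm (f y))\<^sup>2))"
    unfolding complex_norm_square ..
  also have "\<dots> = of_real (LINT y|I_meas. (norm (f y))\<^sup>2)" by (rule integral_complex_of_real)
  finally show ?thesis unfolding L2_norm_power2 .
qed

text \<open>Test functions approximating the conjugate of f turn the orthogonality into a vanishing
  L2 norm of f.\<close>

lemma fundamental_lemma_L2:
  assumes f: "f \<in> L2" and 0: "\<And>\<psi>. \<psi> \<in> test_fun \<Longrightarrow> (LINT y|I_meas. f y * \<psi> y) = 0"
  shows "AE y in I_meas. f y = 0"
proof -
  obtain s where s: "\<And>n. s n \<in> test_fun" "L2_lim s (\<lambda>y. cnj (f y))"
    using test_fun_dense[OF L2_cnj[OF f]] by blast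
  have "(\<lambda>n. LINT y|I_meas. f y * s n y) \<longlonglongrightarrow> (LINT y|I_meas. f y * cnj (f y))"
    by (rule L2_lim_integral[OF s(2) f])
  then have "(LINT y|I_meas. f y * cnj (f y)) = 0"
    using 0[OF s(1)] by (simp add: LIMSEQ_const_iff)
  then have "(LINT y|I_meas. (norm (f y))\<^sup>2) = 0"
    unfolding integral_mult_cnj L2_norm_power2 of_real_eq_0_iff .
  then have "AE y in I_meas. (norm (f y))\<^sup>2 = 0"
    by (subst (asm) integral_nonneg_eq_0_iff_AE) (use L2D(2)[OF f] in auto)
  then show ?thesis by simp
qed

lemma L2_lim_prim:
  assumes s: "L2_lim s g" shows "L2_lim (\<lambda>n. prim (s n)) (prim g)"
proof (rule L2_limI_le)
  note L = L2_limD(1)[OF s] L2_limD(2)[OF s]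
  show "(\<lambda>n. sqrt 2 * L2_norm (\<lambda>y. s n y - g y) * sqrt 2) \<longlonglongrightarrow> 0"
    using s unfolding L2_lim_def by (auto intro!: tendsto_mult_left_zero tendsto_mult_right_zero)
  show "L2_norm (\<lambda>y. prim (s n) y - prim g y) \<le> sqrt 2 * L2_norm (\<lambda>y. s n y - g y) * sqrt 2" for n
    using prim_norm_le[OF L2_diff[OF L(1)[of n] L(2)]]
    by (intro L2_norm_bounded) (auto simp: prim_diff[OF L])
qed (use L2_limD[OF s] in \<open>auto intro: prim_L2\<close>)

text \<open>For g a test function the primitive is smooth and classical integration by parts
  applies; both sides are continuous in g with respect to L2.\<close>

lemma integral_prim_by_parts:
  assumes g: "g \<in> L2" and \<psi>: "\<psi> \<in> test_fun"
  shows "(LINT y|I_meas. prim g y * vderiv \<psi> y) = - (LINT y|I_meas. g y * \<psi> y)"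
proof -
  obtain q where q: "\<And>n. q n \<in> test_fun" "L2_lim q g" using test_fun_dense[OF g] by blast
  have "(LINT y|I_meas. vderiv \<psi> y * prim (q n) y) = - (LINT y|I_meas. \<psi> y * q n y)" for n
  proof -
    obtain \<theta> where \<theta>: "smooth \<theta>" "vderiv \<theta> = q n" "\<And>x. x \<in> {-1..1} \<Longrightarrow> \<theta> x = prim (q n) x"
      using smooth_primitive[OF q(1)] by blast
    have "(LINT y|I_meas. vderiv \<psi> y * prim (q n) y) = (LINT y|I_meas. \<theta> y * vderiv \<psi> y)"
      by (rule Bochner_Integration.integral_cong) (auto simp: \<theta>(3))
    then show ?thesis using integral_by_parts[OF \<psi> \<theta>(1)] by (simp add: \<theta>(2) mult.commute)
  qed
  moreover have "(\<lambda>n. LINT y|I_meas. vderiv \<psi> y * prim (q n) y) \<longlonglongrightarrow> (LINT y|I_meas. vderiv \<psi> y * prim g y)"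
    by (intro L2_lim_integral L2_lim_prim q test_fun_L2 test_fun_vderiv \<psi>)
  moreover have "(\<lambda>n. - (LINT y|I_meas. \<psi> y * q n y)) \<longlonglongrightarrow> - (LINT y|I_meas. \<psi> y * g y)"
    by (intro tendsto_minus L2_lim_integral q test_fun_L2 \<psi>)
  ultimately show ?thesis using LIMSEQ_unique by (simp add: mult.commute)
qed

text \<open>The integrals of the cutoffs tend to 2, the length of I, so one of them is nonzero and
  can be normalised.\<close>

lemma test_fun_integral_1:
  obtains \<eta> where "\<eta> \<in> test_fun" "(LINT y|I_meas. \<eta> y) = 1"
proof -
  have "(\<lambda>n. LINT y|I_meas. 1 * (cutoff n y * 1)) \<longlonglongrightarrow> (LINT y|I_meas. 1 * (1::complex))"
    by (rule L2_lim_integral[OF cutoff_L2_lim[OF L2_const] L2_const])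
  then have "(\<lambda>n. LINT y|I_meas. cutoff n y) \<longlonglongrightarrow> 2" by (simp add: measure_restrict_space scaleR_conv_of_real)
  note lim = this
  have "\<exists>n. (LINT y|I_meas. cutoff n y) \<noteq> 0"
  proof (rule ccontr)
    assume "\<nexists>n. (LINT y|I_meas. cutoff n y) \<noteq> 0"
    then have "(\<lambda>n. 0 :: complex) \<longlonglongrightarrow> 2" using lim by simp
    then show False by (simp add: LIMSEQ_const_iff)
  qed
  then obtain n where n: "(LINT y|I_meas. cutoff n y) \<noteq> 0" by blast
  show ?thesis
    by (rule that[of "\<lambda>y. inverse (LINT y|I_meas. cutoff n y) * cutoff n y"])
      (use n in \<open>auto intro: test_fun_cmult cutoff_test_fun\<close>)
qed

text \<open>The difference F = f - \<open>prim g\<close> annihilates all derivatives of test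
  functions. For any test function q, subtracting its mean times \<eta> leaves such a derivative, so
  F acts on q as the constant c = \<integral> F \<eta>.\<close>

lemma du_Bois_Reymond:
  assumes f: "f \<in> L2" and g: "g \<in> L2"
    and w: "\<And>\<psi>. \<psi> \<in> test_fun \<Longrightarrow> (LINT y|I_meas. f y * vderiv \<psi> y) = - (LINT y|I_meas. g y * \<psi> y)"
  obtains c where "AE y in I_meas. f y = prim g y + c"
proof -
  obtain \<eta> where \<eta>: "\<eta> \<in> test_fun" "(LINT y|I_meas. \<eta> y) = 1" using test_fun_integral_1 by blast
  define F where "F y = f y - prim g y" for y
  have F: "F \<in> L2" unfolding F_def by (intro L2_diff f prim_L2 g)
  have F0: "(LINT y|I_meas. F y * vderiv \<psi> y) = 0" if "\<psi> \<in> test_fun" for \<psi>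
    using w[OF that] integral_prim_by_parts[OF g that]
      L2_mult_integrable(1)[OF f test_fun_L2[OF test_fun_vderiv[OF that]]]
      L2_mult_integrable(1)[OF prim_L2[OF g] test_fun_L2[OF test_fun_vderiv[OF that]]]
    by (simp add: F_def left_diff_distrib)
  define c where "c = (LINT y|I_meas. F y * \<eta> y)"
  have "AE y in I_meas. F y - c = 0"
  proof (rule fundamental_lemma_L2)
    show "(\<lambda>y. F y - c) \<in> L2" by (intro L2_diff F L2_const)
    fix q assume q: "q \<in> test_fun"
    define d where "d = (LINT y|I_meas. q y)"
    have t: "(\<lambda>y. q y + (- d) * \<eta> y) \<in> test_fun" by (intro test_fun_add test_fun_cmult q \<eta>)
    have "(LINT y|I_meas. q y + (- d) * \<eta> y) = 0"
      using q \<eta> by (simp add: test_fun_L2 L2_integrable d_def)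
    then obtain \<psi> where "\<psi> \<in> test_fun" "vderiv \<psi> = (\<lambda>y. q y + (- d) * \<eta> y)"
      using smooth_primitive[OF t] by blast
    then have "(LINT y|I_meas. F y * (q y + (- d) * \<eta> y)) = 0" using F0 by metis
    then have "(LINT y|I_meas. F y * q y - d * (F y * \<eta> y)) = 0"
      by (simp add: algebra_simps)
    then have "(LINT y|I_meas. F y * q y) = d * c"
      using L2_mult_integrable(1)[OF F] q \<eta>(1) by (simp add: test_fun_L2 c_def)
    then show "(LINT y|I_meas. (F y - c) * q y) = 0"
      using L2_mult_integrable(1)[OF F test_fun_L2[OF q]] L2_integrable[OF test_fun_L2[OF q]]
      by (simp add: left_diff_distrib d_def)
  qed
  then have "AE y in I_meas. f y = prim g y + c" by eventually_elim (simp add: F_def algebra_simps)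
  then show ?thesis by (rule that)
qed

section \<open>End point values and the space H10\<close>

text \<open>The zero set is closed and contains almost every point of an open interval, hence the
  whole interval and its closure. This carries a.e. identities to the end points.\<close>

lemma AE_continuous_zero:
  fixes h :: "real \<Rightarrow> complex"
  assumes h: "continuous_on {-1..1} h" and ae: "AE y in I_meas. h y = 0" and y: "y \<in> {-1..1}"
  shows "h y = 0"
proof -
  define C where "C = {y \<in> {-1..1}. h y = 0}"
  have C: "closed C"
    unfolding C_def by (rule continuous_closed_preimage_constant) (use h in auto)
  have "AE y in lebesgue. y \<in> I_dom \<longrightarrow> h y = 0"
    using ae by (subst (asm) AE_restrict_space_iff) auto
  then have "AE y in lebesgue. y \<in> I_dom \<longrightarrow> y \<in> C"
    by eventually_elim (auto simp: C_def)
  from mem_closed_if_AE_lebesgue_open[OF _ C this] have "I_dom \<subseteq> C" by auto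
  then have "closure I_dom \<subseteq> C" using C by (rule closure_minimal)
  then have "{-1..1} \<subseteq> C" by simp
  then show ?thesis using y by (auto simp: C_def)
qed

text \<open>\<open>H1_zero f f'\<close> says that \<open>f\<close> lies in \<open>H\<^sup>1\<^sub>0\<close> with weak derivative \<open>f'\<close>. Carrying \<open>f'\<close> along
  avoids the choice made in \<^const>\<open>weak_deriv\<close>.\<close>

definition H1_zero :: "(real \<Rightarrow> complex) \<Rightarrow> (real \<Rightarrow> complex) \<Rightarrow> bool" where
  "H1_zero f f' \<longleftrightarrow> (\<exists>s. (\<forall>n. s n \<in> test_fun) \<and> L2_lim s f \<and> L2_lim (\<lambda>n. vderiv (s n)) f')"

text \<open>The value 0 at -1 forces f = \<open>prim f'\<close>, and the value 0 at 1 forces f' to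
  have mean zero. So f' is approximated in L2 by test functions; their means d n tend to 0 and are
  removed with \<eta>, and the primitives of the corrected functions are test functions converging
  to f.\<close>

lemma H1_zero_trace:
  assumes f: "f \<in> L2" and f': "f' \<in> L2"
    and w: "\<And>\<psi>. \<psi> \<in> test_fun \<Longrightarrow> (LINT y|I_meas. f y * vderiv \<psi> y) = - (LINT y|I_meas. f' y * \<psi> y)"
    and g: "continuous_on {-1..1} g" "AE y in I_meas. f y = g y" "g (-1) = 0" "g 1 = 0"
  shows "H1_zero f f'"
proof -
  obtain c where c: "AE y in I_meas. f y = prim f' y + c" using du_Bois_Reymond[OF f f' w] by blast
  have "prim f' y + c - g y = 0" if "y \<in> {-1..1}" for y
  proof (rule AE_continuous_zero[OF _ _ that])
    show "continuous_on {-1..1} (\<lambda>y. prim f' y + c - g y)"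
      by (intro continuous_intros prim_continuous f' g(1))
    show "AE y in I_meas. prim f' y + c - g y = 0" using c g(2) by eventually_elim simp
  qed
  from this[of "-1"] this[of 1] have c0: "c = 0" and p1: "(LINT y|I_meas. f' y) = 0"
    using g(3,4) by (auto simp: prim_minus_1 f' prim_1)
  obtain s where s: "\<And>n. s n \<in> test_fun" "L2_lim s f'" using test_fun_dense[OF f'] by blast
  obtain \<eta> where \<eta>: "\<eta> \<in> test_fun" "(LINT y|I_meas. \<eta> y) = 1" using test_fun_integral_1 by blast
  define d where "d n = (LINT y|I_meas. s n y)" for n
  define t where "t n y = s n y + (- d n) * \<eta> y" for n y
  have t: "t n \<in> test_fun" for n unfolding t_def[abs_def] by (intro test_fun_add test_fun_cmult s \<eta>)
  have "d \<longlonglongrightarrow> 0"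
    using L2_lim_integral[OF s(2) L2_const[of 1]] by (simp add: d_def[abs_def] p1)
  have "L2_lim (\<lambda>n y. (- d n) * \<eta> y) (\<lambda>y. 0)"
  proof (rule L2_limI_le)
    show "L2_norm (\<lambda>y. - d n * \<eta> y - 0) \<le> norm (d n) * L2_norm \<eta>" for n
      using L2_norm_cmult[of "- d n" \<eta>] by simp
    show "(\<lambda>n. norm (d n) * L2_norm \<eta>) \<longlonglongrightarrow> 0"
      using \<open>d \<longlonglongrightarrow> 0\<close> by (intro tendsto_mult_left_zero tendsto_norm_zero)
  qed (intro L2_cmult test_fun_L2 \<eta> L2_const)+
  from L2_lim_add[OF s(2) this] have tl: "L2_lim t f'" by (simp add: t_def[abs_def])
  have "(LINT y|I_meas. t n y) = 0" for n
    using s(1)[of n] \<eta> by (simp add: t_def d_def test_fun_L2 L2_integrable)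
  then have "\<exists>\<psi>. \<psi> \<in> test_fun \<and> vderiv \<psi> = t n \<and> (\<forall>x\<in>{-1..1}. \<psi> x = prim (t n) x)" for n
    using smooth_primitive[OF t] by metis
  then obtain \<psi> where \<psi>: "\<And>n. \<psi> n \<in> test_fun" "\<And>n. vderiv (\<psi> n) = t n"
    "\<And>n x. x \<in> {-1..1} \<Longrightarrow> \<psi> n x = prim (t n) x" by metis
  have "L2_norm (\<lambda>y. \<psi> n y - f y) = L2_norm (\<lambda>y. prim (t n) y - prim f' y)" for n
  proof (rule L2_norm_cong_AE)
    show "AE y in I_meas. \<psi> n y - f y = prim (t n) y - prim f' y"
      using c AE_space by eventually_elim (use \<psi>(3) c0 in auto)
  qed (intro L2_diff prim_L2 test_fun_L2 \<psi> f f' t)+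
  then have "L2_lim \<psi> f"
    using L2_lim_prim[OF tl] f \<psi>(1) by (simp add: L2_lim_def test_fun_L2)
  moreover have "L2_lim (\<lambda>n. vderiv (\<psi> n)) f'" using tl by (simp add: \<psi>(2))
  ultimately show ?thesis unfolding H1_zero_def using \<psi>(1) by blast
qed

lemma H1_zeroE:
  assumes "H1_zero f f'"
  obtains s where "\<And>n. s n \<in> test_fun" "L2_lim s f" "L2_lim (\<lambda>n. vderiv (s n)) f'"
  using assms unfolding H1_zero_def by blast

lemma H1_zero_L2: "H1_zero f f' \<Longrightarrow> f \<in> L2" "H1_zero f f' \<Longrightarrow> f' \<in> L2"
  by (auto elim!: H1_zeroE dest: L2_limD)

lemma H1_zero_cnj:
  assumes "H1_zero f f'" shows "H1_zero (\<lambda>y. cnj (f y)) (\<lambda>y. cnj (f' y))"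
proof -
  obtain s where s: "\<And>n. s n \<in> test_fun" "L2_lim s f" "L2_lim (\<lambda>n. vderiv (s n)) f'"
    using H1_zeroE[OF assms] by blast
  show ?thesis unfolding H1_zero_def
    using L2_lim_cnj[OF s(2)] L2_lim_cnj[OF s(3)] s(1)
    by (intro exI[of _ "\<lambda>n y. cnj (s n y)"]) (auto simp: vderiv_cnj test_fun_smooth intro: test_fun_cnj)
qed

lemma L2_lim_mult_continuous:
  assumes s: "L2_lim s f" and a: "continuous_on {-1..1} a"
  shows "L2_lim (\<lambda>n y. a y * s n y) (\<lambda>y. a y * f y)"
proof -
  have "bounded (a ` {-1..1})"
    using a by (intro compact_imp_bounded compact_continuous_image) auto
  then obtain B where B: "\<And>y. y \<in> {-1..1} \<Longrightarrow> norm (a y) \<le> B" "B > 0"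
    unfolding bounded_pos by blast
  show ?thesis
    by (rule L2_lim_mult[OF s, where B=B])
      (use B in \<open>auto intro!: continuous_measurable_I continuous_on_subset[OF a]\<close>)
qed

lemma H1_zero_mult:
  assumes "H1_zero f f'" and a: "smooth a"
  shows "H1_zero (\<lambda>y. a y * f y) (\<lambda>y. a y * f' y + vderiv a y * f y)"
proof -
  obtain s where s: "\<And>n. s n \<in> test_fun" "L2_lim s f" "L2_lim (\<lambda>n. vderiv (s n)) f'"
    using H1_zeroE[OF assms(1)] by blast
  have "L2_lim (\<lambda>n y. a y * s n y) (\<lambda>y. a y * f y)"
    by (intro L2_lim_mult_continuous s smooth_continuous_on a)
  moreover have "L2_lim (\<lambda>n y. a y * vderiv (s n) y + vderiv a y * s n y) (\<lambda>y. a y * f' y + vderiv a y * f y)"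
    by (intro L2_lim_add L2_lim_mult_continuous s smooth_continuous_on smooth_vderiv a)
  ultimately show ?thesis unfolding H1_zero_def
    using s(1) by (intro exI[of _ "\<lambda>n y. a y * s n y"]) (auto simp: vderiv_mult test_fun_smooth a intro: test_fun_mult)
qed

text \<open>Integrate the derivative 2 \<psi> \<psi>' of the complex square \<psi> \<psi>, whose
  modulus is already |\<psi>|^2; no conjugate has to be differentiated.\<close>

lemma test_fun_sup_bound:
  assumes "\<psi> \<in> test_fun"
  shows "(norm (\<psi> y))\<^sup>2 \<le> 2 * (L2_norm \<psi> * L2_norm (vderiv \<psi>))"
proof (cases "y \<in> {-1..1}")
  case True
  note L = test_fun_L2[OF assms] test_fun_L2[OF test_fun_vderiv[OF assms]]
  have t: "(\<lambda>y. \<psi> y * \<psi> y) \<in> test_fun" by (intro test_fun_mult assms test_fun_smooth)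
  have "\<psi> y * \<psi> y = prim (vderiv (\<lambda>y. \<psi> y * \<psi> y)) y"
    using prim_vderiv[OF t] True by simp
  also have "\<dots> = (LINT x|I_meas. \<psi> x * (2 * (indicator {..y} x * vderiv \<psi> x)))"
    unfolding prim_def vderiv_mult[OF test_fun_smooth test_fun_smooth, OF assms assms]
    by (rule Bochner_Integration.integral_cong) (auto simp: algebra_simps)
  finally have "norm (\<psi> y * \<psi> y) \<le> L2_norm \<psi> * L2_norm (\<lambda>x. 2 * (indicator {..y} x * vderiv \<psi> x))"
    using L2_Cauchy_Schwarz[OF L(1) L2_cmult[OF indicator_L2[OF L(2)], of 2 y]] by simp
  also have "\<dots> \<le> L2_norm \<psi> * (2 * (1 * L2_norm (vderiv \<psi>)))"
    unfolding L2_norm_cmult norm_numeral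
    by (intro mult_left_mono L2_norm_bounded_mult L) (auto simp: indicator_def)
  finally show ?thesis by (simp add: norm_mult power2_eq_square)
next
  case False
  then show ?thesis using test_fun_zero[OF assms, of y] by auto
qed

text \<open>The sup bound in integrated form. An element of H10 is given only up to null sets,
  whereas this inequality involves L2 norms alone and so passes to the limit from test
  functions.\<close>

lemma H1_zero_weight:
  assumes "H1_zero f f'" and r: "continuous_on {-1..1} r"
  shows "(L2_norm (\<lambda>y. r y * f y))\<^sup>2 \<le> 2 * (L2_norm r)\<^sup>2 * (L2_norm f * L2_norm f')"
proof -
  obtain s where s: "\<And>n. s n \<in> test_fun" "L2_lim s f" "L2_lim (\<lambda>n. vderiv (s n)) f'"
    using H1_zeroE[OF assms(1)] by blast
  have "(L2_norm (\<lambda>y. r y * s n y))\<^sup>2 \<le> 2 * (L2_norm r)\<^sup>2 * (L2_norm (s n) * L2_norm (vderiv (s n)))" for n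
  proof -
    define M where "M = sqrt (2 * (L2_norm (s n) * L2_norm (vderiv (s n))))"
    have M: "norm (s n y) \<le> M" for y
      unfolding M_def using test_fun_sup_bound[OF s(1)] by (rule real_le_rsqrt)
    have "L2_norm (\<lambda>y. s n y * r y) \<le> M * L2_norm r"
      by (intro L2_norm_bounded_mult M L2_continuous r) (simp add: M_def)
    then have "(L2_norm (\<lambda>y. s n y * r y))\<^sup>2 \<le> (M * L2_norm r)\<^sup>2" by (intro power_mono) auto
    then show ?thesis by (simp add: power_mult_distrib M_def mult_ac)
  qed
  moreover have "(\<lambda>n. (L2_norm (\<lambda>y. r y * s n y))\<^sup>2) \<longlonglongrightarrow> (L2_norm (\<lambda>y. r y * f y))\<^sup>2"
    by (intro tendsto_power L2_lim_norm L2_lim_mult_continuous s r)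
  moreover have "(\<lambda>n. 2 * (L2_norm r)\<^sup>2 * (L2_norm (s n) * L2_norm (vderiv (s n))))
      \<longlonglongrightarrow> 2 * (L2_norm r)\<^sup>2 * (L2_norm f * L2_norm f')"
    by (intro tendsto_intros L2_lim_norm s)
  ultimately show ?thesis by (meson LIMSEQ_le)
qed

text \<open>Extends the weak derivative identity by density; it is what evaluates the pairing of w
  with \<phi>.\<close>

lemma H1_zero_by_parts:
  assumes "H1_zero p p'" and u: "u \<in> L2" "v \<in> L2"
    and w: "\<And>\<psi>. \<psi> \<in> test_fun \<Longrightarrow> (LINT y|I_meas. u y * vderiv \<psi> y) = - (LINT y|I_meas. v y * \<psi> y)"
  shows "(LINT y|I_meas. u y * p' y) = - (LINT y|I_meas. v y * p y)"
proof -
  obtain s where s: "\<And>n. s n \<in> test_fun" "L2_lim s p" "L2_lim (\<lambda>n. vderiv (s n)) p'"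
    using H1_zeroE[OF assms(1)] by blast
  have "(\<lambda>n. LINT y|I_meas. u y * vderiv (s n) y) \<longlonglongrightarrow> (LINT y|I_meas. u y * p' y)"
    by (rule L2_lim_integral[OF s(3) u(1)])
  moreover have "(\<lambda>n. - (LINT y|I_meas. v y * s n y)) \<longlonglongrightarrow> - (LINT y|I_meas. v y * p y)"
    by (intro tendsto_minus L2_lim_integral[OF s(2) u(2)])
  ultimately show ?thesis using LIMSEQ_unique by (simp add: w[OF s(1)])
qed

section \<open>Weak derivatives and the dual norm\<close>

lemma has_weak_deriv_1D:
  assumes "has_weak_deriv 1 f g"
  shows "f \<in> L2" "g \<in> L2" "\<psi> \<in> test_fun \<Longrightarrow> (LINT y|I_meas. f y * vderiv \<psi> y) = - (LINT y|I_meas. g y * \<psi> y)"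
  using assms by (auto simp: has_weak_deriv_def)

lemma has_weak_deriv_unique:
  assumes "has_weak_deriv j f g" "has_weak_deriv j f h"
  shows "AE y in I_meas. g y = h y"
proof -
  have gh: "g \<in> L2" "h \<in> L2" using assms by (auto simp: has_weak_deriv_def)
  have "AE y in I_meas. g y - h y = 0"
  proof (rule fundamental_lemma_L2[OF L2_diff[OF gh]])
    fix \<psi> assume \<psi>: "\<psi> \<in> test_fun"
    have "(-1) ^ j * (LINT y|I_meas. g y * \<psi> y) = (-1) ^ j * (LINT y|I_meas. h y * \<psi> y)"
      using assms \<psi> by (auto simp: has_weak_deriv_def)
    then show "(LINT y|I_meas. (g y - h y) * \<psi> y) = 0"
      using L2_mult_integrable(1)[OF gh(1) test_fun_L2[OF \<psi>]] L2_mult_integrable(1)[OF gh(2) test_fun_L2[OF \<psi>]]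
      by (simp add: left_diff_distrib)
  qed
  then show ?thesis by simp
qed

lemma has_weak_deriv_weak_deriv: "has_weak_deriv j f g \<Longrightarrow> has_weak_deriv j f (weak_deriv j f)"
  unfolding weak_deriv_def by (rule someI[where P="has_weak_deriv j f"])

lemma L2_norm_weak_deriv:
  assumes "has_weak_deriv j f g" shows "L2_norm (weak_deriv j f) = L2_norm g"
  using assms has_weak_deriv_weak_deriv[OF assms] has_weak_deriv_unique
  by (intro L2_norm_cong_AE) (auto simp: has_weak_deriv_def)

lemma test_fun_has_weak_deriv:
  assumes "\<psi> \<in> test_fun" shows "has_weak_deriv 1 \<psi> (vderiv \<psi>)"
  unfolding has_weak_deriv_def
  using integral_by_parts[OF _ test_fun_smooth[OF assms]] assms by (auto intro: test_fun_L2 test_fun_vderiv)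

lemma test_fun_H1_norm: "\<psi> \<in> test_fun \<Longrightarrow> H1_norm \<psi> = sqrt ((L2_norm \<psi>)\<^sup>2 + (L2_norm (vderiv \<psi>))\<^sup>2)"
  unfolding H1_norm_def by (simp only: L2_norm_weak_deriv[OF test_fun_has_weak_deriv])

lemma test_fun_H10:
  assumes "\<psi> \<in> test_fun" shows "\<psi> \<in> H10"
proof -
  have "has_weak_deriv 0 \<psi> \<psi>" using assms by (simp add: has_weak_deriv_def test_fun_L2)
  then have "\<psi> \<in> Sobolev 1"
    unfolding Sobolev_def using test_fun_has_weak_deriv[OF assms] by (auto simp: le_Suc_eq)
  moreover have "H1_norm (\<lambda>y. \<psi> y - \<psi> y) = 0"
  proof -
    have "(\<lambda>y. 0) \<in> test_fun" using test_fun_cmult[OF assms, of 0] by simp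
    moreover have "vderiv (\<lambda>y. 0) = (\<lambda>y. 0)" by (rule vderiv_eq) simp
    ultimately show ?thesis by (simp add: test_fun_H1_norm)
  qed
  ultimately show ?thesis using assms by (auto simp: H10_def intro!: bexI[of _ \<psi>])
qed

text \<open>Scaling to the unit ball. Boundedness of F is used to see that the supremum is taken
  over a set that is bounded above.\<close>

lemma Hminus1_test_fun:
  assumes F: "F \<in> Hminus1" and \<psi>: "\<psi> \<in> test_fun"
  shows "norm (F \<psi>) \<le> Hminus1_norm F * H1_norm \<psi>"
proof -
  have "\<exists>B. \<forall>f\<in>H10. norm (F f) \<le> B * H1_norm f" using F by (simp add: Hminus1_def)
  then obtain B where B: "\<And>f. f \<in> H10 \<Longrightarrow> norm (F f) \<le> B * H1_norm f" by blast
  have hom: "F (\<lambda>y. c * f y) = c * F f" if "f \<in> H10" for c f using F that by (auto simp: Hminus1_def)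
  have H0: "0 \<le> H1_norm \<psi>" by (simp add: H1_norm_def)
  show ?thesis
  proof (cases "H1_norm \<psi> = 0")
    \<comment> \<open>A function of norm zero cannot be normalised; the boundedness constant of F
      disposes of it directly.\<close>
    case True
    then show ?thesis using B[OF test_fun_H10[OF \<psi>]] by simp
  next
    case False
    then have pos: "H1_norm \<psi> > 0" using H0 by simp
    define c where "c = inverse (H1_norm \<psi>)"
    define \<theta> where "\<theta> y = of_real c * \<psi> y" for y
    have \<theta>: "\<theta> \<in> test_fun" unfolding \<theta>_def[abs_def] by (intro test_fun_cmult \<psi>)
    have c: "c > 0" using pos by (simp add: c_def)
    have "H1_norm \<theta> = sqrt (c\<^sup>2 * ((L2_norm \<psi>)\<^sup>2 + (L2_norm (vderiv \<psi>))\<^sup>2))"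
      unfolding test_fun_H1_norm[OF \<theta>] unfolding \<theta>_def[abs_def] vderiv_cmult[OF test_fun_smooth[OF \<psi>]] L2_norm_cmult
      by (simp add: power_mult_distrib distrib_left)
    also have "\<dots> = 1" using c pos unfolding real_sqrt_mult test_fun_H1_norm[OF \<psi>, symmetric] by (simp add: c_def)
    finally have "H1_norm \<theta> \<le> 1" by simp
    moreover have "bdd_above ((\<lambda>f. norm (F f)) ` {f \<in> H10. H1_norm f \<le> 1})"
    proof (rule bdd_aboveI2)
      fix f assume f: "f \<in> {f \<in> H10. H1_norm f \<le> 1}"
      have "norm (F f) \<le> B * H1_norm f" using f B by simp
      also have "\<dots> \<le> \<bar>B\<bar> * 1" by (intro mult_mono) (use f in \<open>auto simp: H1_norm_def\<close>)
      finally show "norm (F f) \<le> \<bar>B\<bar>" by simp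
    qed
    ultimately have "norm (F \<theta>) \<le> Hminus1_norm F"
      unfolding Hminus1_norm_def using test_fun_H10[OF \<theta>] by (intro cSUP_upper) auto
    moreover have "norm (F \<theta>) = c * norm (F \<psi>)"
      unfolding \<theta>_def[abs_def] hom[OF test_fun_H10[OF \<psi>]] using c by (simp add: norm_mult)
    ultimately show ?thesis using pos by (simp add: c_def field_simps)
  qed
qed

section \<open>The multiplier\<close>

definition weight :: "real \<Rightarrow> real \<Rightarrow> real \<Rightarrow> real" where
  "weight l h y = inverse ((y - l)\<^sup>2 + h\<^sup>2)"

text \<open>The real part of 1 / (y - l - \<i> h), that is, 1 / (y - l) regularised at distance h
  from l.\<close>

definition layer_mult :: "real \<Rightarrow> real \<Rightarrow> real \<Rightarrow> complex" where
  "layer_mult l h y = of_real ((y - l) * weight l h y)"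

context
  fixes l h :: real
  assumes h: "h > 0"
begin

lemma denom_pos: "(y - l)\<^sup>2 + h\<^sup>2 > 0"
  using h by (simp add: add_nonneg_pos)

lemma weight_pos: "weight l h y > 0"
  using denom_pos by (simp add: weight_def)

lemma weight_denom: "((y - l)\<^sup>2 + h\<^sup>2) * weight l h y = 1"
  unfolding weight_def using denom_pos[of y] by (intro right_inverse) linarith

lemma weight_le: "weight l h y \<le> (1 / h)\<^sup>2"
proof -
  have "inverse ((y - l)\<^sup>2 + h\<^sup>2) \<le> inverse (h\<^sup>2)"
    using h by (intro le_imp_inverse_le) auto
  then show ?thesis by (simp add: weight_def power_divide inverse_eq_divide)
qed

lemma weight_continuous: "continuous_on S (weight l h)"
  unfolding weight_def using denom_pos by (intro continuous_intros) (metis less_irrefl)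

lemma sqrt_weight_le: "sqrt (weight l h y) \<le> 1 / h"
  using real_sqrt_le_mono[OF weight_le[of y]] h by simp

lemma weight_decomp: "(y - l)\<^sup>2 * weight l h y = 1 - h\<^sup>2 * weight l h y"
  using weight_denom[of y] unfolding distrib_right by linarith

text \<open>The square is (1 - h^2 \<open>weight\<close>) \<open>weight\<close>. The first bound is
  kept for the factor f, where the weight can be exploited; the second is all that can be afforded
  on f'.\<close>

lemma layer_mult_norm_le: "norm (layer_mult l h y) \<le> sqrt (weight l h y)" "norm (layer_mult l h y) \<le> 1 / h"
proof -
  have "(norm (layer_mult l h y))\<^sup>2 = (y - l)\<^sup>2 * weight l h y * weight l h y"
    unfolding layer_mult_def norm_of_real power2_abs by (simp only: power_mult_distrib power2_eq_square mult_ac)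
  also have "\<dots> \<le> 1 * weight l h y"
    using weight_pos[of y] unfolding weight_decomp by (intro mult_right_mono) auto
  finally show 1: "norm (layer_mult l h y) \<le> sqrt (weight l h y)" by (intro real_le_rsqrt) simp
  then show "norm (layer_mult l h y) \<le> 1 / h" using sqrt_weight_le order_trans by blast
qed

lemma smooth_layer_mult: "smooth (layer_mult l h)"
proof -
  have "smooth (\<lambda>y. of_real y + of_real (- l))" by (intro smooth_add smooth_of_real smooth_const)
  then have t: "smooth (\<lambda>y. of_real (y - l))" by simp
  have nz: "of_real (y - l) * of_real (y - l) + of_real (h\<^sup>2) \<noteq> (0::complex)" for y
  proof -
    have "of_real ((y - l)\<^sup>2 + h\<^sup>2) \<noteq> (0::complex)" using denom_pos[of y] by (metis less_irrefl of_real_eq_0_iff)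
    then show ?thesis by (simp add: power2_eq_square)
  qed
  have "smooth (\<lambda>y. of_real (y - l) * inverse (of_real (y - l) * of_real (y - l) + of_real (h\<^sup>2)))"
    by (intro smooth_mult t smooth_inverse nz smooth_add smooth_const)
  moreover have "layer_mult l h = (\<lambda>y. of_real (y - l) * inverse (of_real (y - l) * of_real (y - l) + of_real (h\<^sup>2)))"
    by (rule ext) (simp add: layer_mult_def weight_def power2_eq_square)
  ultimately show ?thesis by simp
qed

lemma vderiv_layer_mult: "vderiv (layer_mult l h) = (\<lambda>y. of_real ((h\<^sup>2 - (y - l)\<^sup>2) * (weight l h y)\<^sup>2))"
proof (rule vderiv_eq)
  fix y
  have "((\<lambda>y. (y - l) * weight l h y) has_real_derivative (h\<^sup>2 - (y - l)\<^sup>2) * (weight l h y)\<^sup>2) (at y)"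
  proof -
    have "((\<lambda>y. (y - l)\<^sup>2 + h\<^sup>2) has_real_derivative 2 * (y - l)) (at y)"
      by (auto intro!: derivative_eq_intros)
    from DERIV_mult[OF _ DERIV_inverse'[OF this]]
    have "((\<lambda>y. (y - l) * weight l h y) has_real_derivative
        1 * weight l h y + - (weight l h y * (2 * (y - l)) * weight l h y) * (y - l)) (at y)"
      unfolding weight_def using denom_pos[of y] by (auto intro!: derivative_eq_intros)
    moreover have "1 * weight l h y + - (weight l h y * (2 * (y - l)) * weight l h y) * (y - l)
        = ((y - l)\<^sup>2 + h\<^sup>2) * weight l h y * weight l h y - 2 * (y - l)\<^sup>2 * (weight l h y)\<^sup>2"
      unfolding weight_denom by (simp only: power2_eq_square mult_ac mult_1 mult_minus_left diff_conv_add_uminus)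
    moreover have "\<dots> = (h\<^sup>2 - (y - l)\<^sup>2) * (weight l h y)\<^sup>2"
      unfolding power2_eq_square[of "weight l h y"] distrib_right left_diff_distrib by (simp add: mult.assoc)
    ultimately show ?thesis by simp
  qed
  from has_vector_derivative_of_real[OF this]
  show "(layer_mult l h has_vector_derivative of_real ((h\<^sup>2 - (y - l)\<^sup>2) * (weight l h y)\<^sup>2)) (at y)"
    by (simp add: layer_mult_def[abs_def])
qed

lemma vderiv_layer_mult_norm_le: "norm (vderiv (layer_mult l h) y) \<le> weight l h y"
proof -
  have "\<bar>(h\<^sup>2 - (y - l)\<^sup>2)\<bar> * (weight l h y)\<^sup>2 \<le> ((y - l)\<^sup>2 + h\<^sup>2) * (weight l h y)\<^sup>2"
    by (intro mult_right_mono) (auto simp: abs_le_iff)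
  also have "\<dots> = weight l h y"
    unfolding power2_eq_square[of "weight l h y"] mult.assoc[symmetric] weight_denom by simp
  finally show ?thesis unfolding vderiv_layer_mult norm_of_real abs_mult by simp
qed

text \<open>The square root lets the layer term h^2 \<open>weight\<close> be shared equally by the
  two factors in Cauchy-Schwarz.\<close>

abbreviation root_weight :: "real \<Rightarrow> complex" where "root_weight y \<equiv> of_real (sqrt (weight l h y))"

lemma root_weight_continuous: "continuous_on S root_weight"
  by (intro continuous_intros weight_continuous)

text \<open>The arctangent has total variation \<pi>, wherever l lies; this is the source of
  uniformity in \<lambda>.\<close>

lemma root_weight_norm: "(L2_norm root_weight)\<^sup>2 \<le> pi / h"
proof -
  have d: "((\<lambda>y. arctan ((y - l) / h) / h) has_real_derivative weight l h y) (at y)" for y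
  proof -
    have "((\<lambda>y. arctan ((y - l) / h) / h) has_real_derivative (inverse (1 + ((y - l) / h)\<^sup>2) * (1 / h)) / h) (at y)"
      using h by (auto intro!: derivative_eq_intros simp: divide_inverse)
    moreover have "(inverse (1 + ((y - l) / h)\<^sup>2) * (1 / h)) / h = weight l h y"
    proof -
      have "(1 + (t / h)\<^sup>2) * (h * h) = t\<^sup>2 + h\<^sup>2" for t
        using h by (simp add: field_simps power2_eq_square)
      from this[of "y - l", symmetric] show ?thesis
        unfolding weight_def by (simp only: divide_inverse inverse_mult_distrib mult_1 mult_ac)
    qed
    ultimately show ?thesis by simp
  qed
  have "(L2_norm root_weight)\<^sup>2 = (LINT y|I_meas. weight l h y)"
    unfolding L2_norm_power2 using weight_pos by (simp add: less_imp_le)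
  also have "\<dots> = integral I_dom (weight l h)"
  proof (rule lebesgue_integral_eq_integral)
    have "integrable I_meas (\<lambda>y. (norm (root_weight y))\<^sup>2)" by (intro L2D L2_continuous root_weight_continuous)
    then show "integrable I_meas (weight l h)" using weight_pos by (simp add: less_imp_le)
  qed simp
  also have "\<dots> = integral {-1..1} (weight l h)" by (rule integral_open_interval_real[symmetric])
  also have "\<dots> = arctan ((1 - l) / h) / h - arctan ((-1 - l) / h) / h"
    by (intro integral_unique fundamental_theorem_of_calculus)
      (use d in \<open>auto simp flip: has_real_derivative_iff_has_vector_derivative intro: has_field_derivative_at_within\<close>)
  also have "\<dots> = (arctan ((1 - l) / h) - arctan ((-1 - l) / h)) / h" by (simp add: diff_divide_distrib)
  also have "\<dots> \<le> pi / h"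
    using arctan_ubound[of "(1 - l) / h"] arctan_lbound[of "(-1 - l) / h"] h by (intro divide_right_mono) auto
  finally show ?thesis .
qed

lemma root_weight_mult_le:
  assumes f: "f \<in> L2" shows "L2_norm (\<lambda>y. root_weight y * f y) \<le> L2_norm f / h"
proof -
  have "L2_norm (\<lambda>y. root_weight y * f y) \<le> (1 / h) * L2_norm f"
    using h sqrt_weight_le weight_pos by (intro L2_norm_bounded_mult f) (auto simp: less_imp_le)
  then show ?thesis by simp
qed

text \<open>Gains over \<open>root_weight_mult_le\<close> by trading a factor of the norm of f over
  h for the norm of f'. The constant is 2 * 4, from the sup bound and \<pi> < 4.\<close>

lemma root_weight_mult_sq_le:
  assumes "H1_zero f f'"
  shows "(L2_norm (\<lambda>y. root_weight y * f y))\<^sup>2 \<le> 8 / h * (L2_norm f * L2_norm f')"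
proof -
  have "(L2_norm (\<lambda>y. root_weight y * f y))\<^sup>2 \<le> 2 * (L2_norm root_weight)\<^sup>2 * (L2_norm f * L2_norm f')"
    by (rule H1_zero_weight[OF assms root_weight_continuous])
  also have "\<dots> \<le> 2 * (4 / h) * (L2_norm f * L2_norm f')"
  proof (intro mult_right_mono mult_left_mono)
    have "pi / h \<le> 4 / h" using pi_less_4 h by (simp add: divide_right_mono)
    then show "(L2_norm root_weight)\<^sup>2 \<le> 4 / h" using root_weight_norm by simp
  qed auto
  finally show ?thesis by simp
qed

lemma root_weight_L2: "f \<in> L2 \<Longrightarrow> (\<lambda>y. root_weight y * f y) \<in> L2"
  using h sqrt_weight_le weight_pos root_weight_continuous
  by (intro L2_bounded_mult[where B="1/h"] continuous_measurable_I) (auto simp: less_imp_le)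

text \<open>Testing with \<open>layer_mult l h * cnj f\<close>: since \<open>(y - l)\<close> times the multiplier is
  \<open>1 - h\<^sup>2 / ((y - l)\<^sup>2 + h\<^sup>2)\<close>, only the layer of width \<open>h\<close> around \<open>l\<close> is lost.\<close>

lemma multiplier_estimate:
  fixes w w' f f' :: "real \<Rightarrow> complex" and \<nu> k N \<delta> :: real
  assumes w: "w \<in> L2" "w' \<in> L2" and f: "H1_zero f f'"
    and nn: "0 \<le> \<nu>" "0 \<le> \<delta>" "0 \<le> N"
    and weak: "\<And>p p'. H1_zero p p' \<Longrightarrow>
      norm (of_real \<nu> * ((LINT y|I_meas. w' y * p' y) + of_real k ^ 2 * (LINT y|I_meas. w y * p y))
        + \<i> * of_real k * (LINT y|I_meas. w y * (of_real (y - l) * p y))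
        - of_real \<delta> * (LINT y|I_meas. w y * p y)) \<le> N * (L2_norm p + L2_norm p')"
  shows "\<bar>k\<bar> * norm (LINT y|I_meas. w y * cnj (f y))
    \<le> \<bar>k\<bar> * h\<^sup>2 * (L2_norm (\<lambda>y. root_weight y * w y) * L2_norm (\<lambda>y. root_weight y * f y))
      + (N + \<nu> * L2_norm w') * ((L2_norm (\<lambda>y. root_weight y * f y) + L2_norm f') / h)
      + (N + \<nu> * k\<^sup>2 * L2_norm w + \<delta> * L2_norm w) * L2_norm (\<lambda>y. root_weight y * f y)"
proof -
  note fL = H1_zero_L2[OF f] L2_cnj[OF H1_zero_L2(1)[OF f]] L2_cnj[OF H1_zero_L2(2)[OF f]]
  let ?\<rho> = "L2_norm (\<lambda>y. root_weight y * f y)"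
  define p where "p y = layer_mult l h y * cnj (f y)" for y
  define p' where "p' y = layer_mult l h y * cnj (f' y) + vderiv (layer_mult l h) y * cnj (f y)" for y
  have p: "H1_zero p p'"
    unfolding p_def p'_def by (intro H1_zero_mult H1_zero_cnj f smooth_layer_mult)
  note pL = H1_zero_L2[OF p]
  have q: "L2_norm (\<lambda>y. p y) \<le> ?\<rho>"
    unfolding p_def by (rule L2_norm_mono[OF L2D(2)[OF root_weight_L2[OF fL(1)]]])
      (use layer_mult_norm_le(1) weight_pos in \<open>auto simp: norm_mult less_imp_le intro!: mult_right_mono\<close>)
  have m1: "L2_norm (\<lambda>y. layer_mult l h y * cnj (f' y)) \<le> 1 / h * L2_norm f'"
    using L2_norm_bounded_mult[OF fL(4), of "1/h" "layer_mult l h"] h layer_mult_norm_le(2) by (simp add: L2_norm_cnj)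
  have m2: "L2_norm (\<lambda>y. vderiv (layer_mult l h) y * cnj (f y)) \<le> 1 / h * ?\<rho>"
  proof -
    have "L2_norm (\<lambda>y. vderiv (layer_mult l h) y * cnj (f y)) \<le> L2_norm (\<lambda>y. of_real (1 / h) * (root_weight y * f y))"
    proof (rule L2_norm_mono[OF L2D(2)[OF L2_cmult[OF root_weight_L2[OF fL(1)]]]])
      fix y
      \<comment> \<open>One of the two square roots is spent on the bound 1 / h, the other stays to
        form the weighted norm of f.\<close>
      have "norm (vderiv (layer_mult l h) y) \<le> sqrt (weight l h y) * sqrt (weight l h y)"
        using vderiv_layer_mult_norm_le[of y] weight_pos[of y] by simp
      also have "\<dots> \<le> 1 / h * sqrt (weight l h y)"
        using weight_pos[of y] by (intro mult_right_mono sqrt_weight_le) (simp add: less_imp_le)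
      finally have "norm (vderiv (layer_mult l h) y) * norm (f y) \<le> 1 / h * sqrt (weight l h y) * norm (f y)"
        by (intro mult_right_mono) auto
      then show "norm (vderiv (layer_mult l h) y * cnj (f y)) \<le> norm (of_real (1 / h) * (root_weight y * f y))"
        using weight_pos[of y] h by (simp add: norm_mult norm_divide less_imp_le mult_ac)
    qed
    also have "\<dots> = 1 / h * ?\<rho>" unfolding L2_norm_cmult norm_of_real using h by simp
    finally show ?thesis .
  qed
  have mL: "(\<lambda>y. layer_mult l h y * cnj (f' y)) \<in> L2" "(\<lambda>y. vderiv (layer_mult l h) y * cnj (f y)) \<in> L2"
  proof -
    show "(\<lambda>y. layer_mult l h y * cnj (f' y)) \<in> L2"
      using layer_mult_norm_le(2) by (intro L2_bounded_mult[where B="1/h"] fL continuous_measurable_I smooth_continuous_on smooth_layer_mult)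
    have "norm (vderiv (layer_mult l h) y) \<le> (1/h)\<^sup>2" for y using vderiv_layer_mult_norm_le[of y] weight_le[of y] by linarith
    then show "(\<lambda>y. vderiv (layer_mult l h) y * cnj (f y)) \<in> L2"
      by (intro L2_bounded_mult[where B="(1/h)\<^sup>2"] fL continuous_measurable_I smooth_continuous_on smooth_vderiv smooth_layer_mult)
  qed
  have q': "L2_norm p' \<le> (?\<rho> + L2_norm f') / h"
    using L2_norm_triangle[OF mL] m1 m2 unfolding p'_def by (simp add: add_divide_distrib)
  define X where "X = (LINT y|I_meas. w y * (of_real (y - l) * p y))"
  have X: "X = (LINT y|I_meas. w y * cnj (f y)) - of_real (h\<^sup>2) * (LINT y|I_meas. (root_weight y * w y) * (root_weight y * cnj (f y)))"
  proof -
    have e: "of_real (y - l) * p y = cnj (f y) - of_real (h\<^sup>2) * (root_weight y * (root_weight y * cnj (f y)))" for y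
    proof -
      have "of_real (y - l) * p y = of_real ((y - l)\<^sup>2 * weight l h y) * cnj (f y)"
        by (simp add: p_def layer_mult_def power2_eq_square mult_ac)
      moreover have "root_weight y * root_weight y = of_real (weight l h y)"
        unfolding of_real_mult[symmetric] using weight_pos[of y] by simp
      ultimately show ?thesis unfolding weight_decomp
        by (simp add: left_diff_distrib mult.assoc[symmetric])
    qed
    have "X = (LINT y|I_meas. w y * cnj (f y) - of_real (h\<^sup>2) * ((root_weight y * w y) * (root_weight y * cnj (f y))))"
      unfolding X_def e by (simp add: algebra_simps)
    also have "\<dots> = (LINT y|I_meas. w y * cnj (f y)) - of_real (h\<^sup>2) * (LINT y|I_meas. (root_weight y * w y) * (root_weight y * cnj (f y)))"
      by (subst Bochner_Integration.integral_diff)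
        (auto intro!: L2_mult_integrable(1) integrable_mult_right w fL root_weight_L2)
    finally show ?thesis .
  qed
  have cs: "norm (LINT y|I_meas. (root_weight y * w y) * (root_weight y * cnj (f y))) \<le> L2_norm (\<lambda>y. root_weight y * w y) * ?\<rho>"
    using L2_Cauchy_Schwarz[OF root_weight_L2[OF w(1)] root_weight_L2[OF fL(3)]] L2_norm_cnj[of "\<lambda>y. root_weight y * f y"] by simp
  define Y Z where "Y = (LINT y|I_meas. w' y * p' y)" and "Z = (LINT y|I_meas. w y * p y)"
  have Y: "norm Y \<le> L2_norm w' * L2_norm p'" unfolding Y_def by (rule L2_Cauchy_Schwarz[OF w(2) pL(2)])
  have Z: "norm Z \<le> L2_norm w * L2_norm p" unfolding Z_def by (rule L2_Cauchy_Schwarz[OF w(1) pL(1)])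
  define A where "A = of_real \<nu> * (Y + of_real k ^ 2 * Z) + \<i> * of_real k * X - of_real \<delta> * Z"
  have A: "norm A \<le> N * (L2_norm p + L2_norm p')" unfolding A_def X_def Y_def Z_def by (rule weak[OF p])
  have "\<bar>k\<bar> * norm X = norm (\<i> * of_real k * X)" by (simp add: norm_mult)
  \<comment> \<open>A is the tested equation, bounded by the dual norm; the remaining terms are the
    diffusive and \<epsilon>-terms moved to the other side.\<close>
  also have "\<i> * of_real k * X = A + (- of_real \<nu> * Y) + (- of_real (\<nu> * k\<^sup>2) * Z) + of_real \<delta> * Z"
    by (simp add: A_def algebra_simps)
  also have "norm \<dots> \<le> norm A + norm (- of_real \<nu> * Y) + norm (- of_real (\<nu> * k\<^sup>2) * Z) + norm (of_real \<delta> * Z)"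
    by (intro order_trans[OF norm_triangle_ineq] add_mono order_refl)
  also have "\<dots> = norm A + \<nu> * norm Y + \<nu> * k\<^sup>2 * norm Z + \<delta> * norm Z"
    using nn by (simp add: norm_mult norm_power)
  also have "\<dots> \<le> N * (L2_norm p + L2_norm p') + \<nu> * (L2_norm w' * L2_norm p')
      + \<nu> * k\<^sup>2 * (L2_norm w * L2_norm p) + \<delta> * (L2_norm w * L2_norm p)"
    using nn by (intro add_mono A mult_left_mono Y Z) auto
  also have "\<dots> = (N + \<nu> * L2_norm w') * L2_norm p' + (N + \<nu> * k\<^sup>2 * L2_norm w + \<delta> * L2_norm w) * L2_norm p"
    by (simp add: algebra_simps)
  also have "\<dots> \<le> (N + \<nu> * L2_norm w') * ((?\<rho> + L2_norm f') / h) + (N + \<nu> * k\<^sup>2 * L2_norm w + \<delta> * L2_norm w) * ?\<rho>"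
    using nn q q' by (intro add_mono mult_left_mono) auto
  finally have kX: "\<bar>k\<bar> * norm X \<le> \<dots>" .
  have "norm (LINT y|I_meas. w y * cnj (f y)) = norm (X + of_real (h\<^sup>2) * (LINT y|I_meas. (root_weight y * w y) * (root_weight y * cnj (f y))))"
    by (simp add: X)
  also have "\<dots> \<le> norm X + h\<^sup>2 * (L2_norm (\<lambda>y. root_weight y * w y) * ?\<rho>)"
    by (rule order_trans[OF norm_triangle_ineq]) (use cs in \<open>auto simp: norm_mult norm_power intro: mult_left_mono\<close>)
  finally have "\<bar>k\<bar> * norm (LINT y|I_meas. w y * cnj (f y)) \<le> \<bar>k\<bar> * (norm X + h\<^sup>2 * (L2_norm (\<lambda>y. root_weight y * w y) * ?\<rho>))"
    by (intro mult_left_mono) auto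
  then show ?thesis using kX by (simp add: algebra_simps)
qed

end

section \<open>A priori estimates\<close>

text \<open>Applied with \<open>a = \<parallel>w\<parallel> / h\<close>, \<open>b = \<parallel>w'\<parallel>\<close>, \<open>E\<^sup>2 = \<parallel>w'\<parallel>\<^sup>2 + k\<^sup>2 \<parallel>w\<parallel>\<^sup>2\<close> and \<open>n = \<parallel>F\<parallel> / \<nu>\<close>.\<close>

lemma energy_bootstrap:
  fixes a b E n \<epsilon> :: real
  assumes nn: "0 \<le> a" "0 \<le> b" "0 \<le> E" "0 \<le> n" and \<epsilon>: "0 \<le> \<epsilon>" "\<epsilon> \<le> 1/1000" and bE: "b \<le> E"
    and energy: "E\<^sup>2 \<le> \<epsilon> * a\<^sup>2 + n * E"
    and layer: "a\<^sup>2 \<le> 8 * a * b + (n + b) * (a + b) + n * a + E\<^sup>2 + \<epsilon> * a\<^sup>2"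
  shows "E \<le> 2 * n" "a \<le> 33 * n"
proof -
  define S where "S = E + n"
  have S: "0 \<le> S" using nn by (simp add: S_def)
  have e1: "\<epsilon> * a\<^sup>2 \<le> 1/1000 * a\<^sup>2" using \<epsilon> by (intro mult_right_mono) auto
  \<comment> \<open>If a > 11 S, the layer inequality gives a^2 \<le> (9/11 + 2/121 + 1/1000) a^2, a
    factor below 1.\<close>
  have aS: "a \<le> 11 * S"
  proof (rule ccontr)
    assume "\<not> a \<le> 11 * S"
    then have aS: "11 * S < a" by simp
    then have a: "0 < a" using S by linarith
    have "8 * a * b + (n + b) * (a + b) + n * a + E\<^sup>2 \<le> 8 * a * E + (n + E) * (a + E) + n * a + E\<^sup>2"
      using nn bE by (intro add_mono mult_mono order_refl) auto
    also have "\<dots> \<le> 9 * a * S + 2 * S\<^sup>2"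
      using nn by (simp add: S_def power2_eq_square algebra_simps)
    also have "\<dots> \<le> 9 * a * (a / 11) + 2 * (a / 11)\<^sup>2"
      using S aS a by (intro add_mono mult_left_mono power_mono) auto
    finally have "a\<^sup>2 \<le> 9/11 * a\<^sup>2 + 2/121 * a\<^sup>2 + 1/1000 * a\<^sup>2"
      using layer e1 by (simp add: power2_eq_square)
    moreover have "a\<^sup>2 > 0" using a by simp
    ultimately show False by linarith
  qed
  \<comment> \<open>Otherwise S < 3/2 E, and the energy inequality bounds E^2 by (121 * 9/4 / 1000 +
    1/2) E^2, about 0.77 E^2. This is where \<epsilon> must be small. The 33 below is then 11 * (2 +
    1).\<close>
  show E2: "E \<le> 2 * n"
  proof (rule ccontr)
    assume "\<not> E \<le> 2 * n"
    then have En: "n < E / 2" by simp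
    then have E: "E > 0" using nn by linarith
    have "a\<^sup>2 \<le> (11 * (3/2 * E))\<^sup>2" using nn aS En by (intro power_mono) (auto simp: S_def)
    moreover have "n * E \<le> E / 2 * E" using En E by (intro mult_right_mono) auto
    ultimately have "E\<^sup>2 \<le> 1/1000 * (11 * (3/2 * E))\<^sup>2 + 1/2 * E\<^sup>2"
      using energy e1 by (simp add: power2_eq_square)
    then have "E\<^sup>2 \<le> 1/1000 * (121 * 9/4) * E\<^sup>2 + 1/2 * E\<^sup>2" by (simp add: power2_eq_square)
    moreover have "E\<^sup>2 > 0" using E by simp
    ultimately show False by linarith
  qed
  then show "a \<le> 33 * n" using aS by (simp add: S_def)
qed

text \<open>The analytic core, free of distributions: F survives only through the bound N on the
  tested equation. By |k| h^3 = \<nu> one has \<nu> k^2 = (|k| h)^3, so the factor in the third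
  estimate is the square root of \<nu> k^2.\<close>

lemma OS_form_estimates:
  fixes w w' \<phi> \<phi>' :: "real \<Rightarrow> complex" and \<nu> k l h \<epsilon> N :: real
  assumes \<nu>: "0 < \<nu>" and k: "1 \<le> \<bar>k\<bar>" and \<epsilon>: "0 \<le> \<epsilon>" "\<epsilon> \<le> 1/1000" and N: "0 \<le> N"
    and h: "0 < h" "h \<le> 1" "\<bar>k\<bar> * h ^ 3 = \<nu>"
    and w: "H1_zero w w'" and \<phi>: "H1_zero \<phi> \<phi>'"
    and \<phi>w: "\<And>\<psi>. \<psi> \<in> test_fun \<Longrightarrow>
      (LINT y|I_meas. \<phi>' y * vderiv \<psi> y) = - (LINT y|I_meas. (w y + of_real k ^ 2 * \<phi> y) * \<psi> y)"
    and weak: "\<And>p p'. H1_zero p p' \<Longrightarrow>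
      norm (of_real \<nu> * ((LINT y|I_meas. w' y * p' y) + of_real k ^ 2 * (LINT y|I_meas. w y * p y))
        + \<i> * of_real k * (LINT y|I_meas. w y * (of_real (y - l) * p y))
        - of_real (\<epsilon> * \<nu> / h\<^sup>2) * (LINT y|I_meas. w y * p y)) \<le> N * sqrt ((L2_norm p)\<^sup>2 + (L2_norm p')\<^sup>2)"
  shows "\<nu> * L2_norm w' \<le> 2 * N" "\<nu> / h * L2_norm w \<le> 33 * N"
    "(\<bar>k\<bar> * h) * sqrt (\<bar>k\<bar> * h) * sqrt ((L2_norm \<phi>')\<^sup>2 + k\<^sup>2 * (L2_norm \<phi>)\<^sup>2) \<le> 83 * N"
proof -
  define b n a W where "b = L2_norm w'" and "n = N / \<nu>" and "a = L2_norm w / h" and "W = L2_norm w"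
  define E where "E = sqrt (b\<^sup>2 + k\<^sup>2 * W\<^sup>2)"
  define \<delta> where "\<delta> = \<epsilon> * \<nu> / h\<^sup>2"
  define s where "s = \<bar>k\<bar> * h"
  note wL = H1_zero_L2[OF w] and \<phi>L = H1_zero_L2[OF \<phi>]
  have nn: "0 \<le> b" "0 \<le> n" "0 \<le> a" "0 \<le> W" "0 \<le> E" "0 \<le> \<delta>" and s: "s > 0"
    using \<nu> h N k \<epsilon> by (auto simp: b_def n_def a_def W_def E_def \<delta>_def s_def)
  have N_eq: "N = \<nu> * n" using \<nu> by (simp add: n_def)
  have W_eq: "W = h * a" using h by (simp add: a_def W_def)
  have Wa: "W \<le> a" unfolding W_eq using nn h by (simp add: mult_left_le_one_le)
  have E2: "E\<^sup>2 = b\<^sup>2 + k\<^sup>2 * W\<^sup>2" by (simp add: E_def)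
  have bE: "b \<le> E" unfolding E_def by (rule real_le_rsqrt) simp
  have kWE: "\<bar>k\<bar> * W \<le> E" unfolding E_def by (rule real_le_rsqrt) (simp add: power_mult_distrib)
  have k2: "1 \<le> k\<^sup>2" using k power_mono[of 1 "\<bar>k\<bar>" 2] by simp

  have norm_le_sum: "sqrt (x\<^sup>2 + y\<^sup>2) \<le> x + y" if "0 \<le> x" "0 \<le> y" for x y :: real
    using that by (intro real_le_lsqrt) (auto simp: power2_sum)
  \<comment> \<open>The multiplier estimate takes the sum of norms; the energy estimate keeps the
    sharper square root, which is at most E because k^2 \<ge> 1.\<close>
  have weak': "norm (of_real \<nu> * ((LINT y|I_meas. w' y * p' y) + of_real k ^ 2 * (LINT y|I_meas. w y * p y))
        + \<i> * of_real k * (LINT y|I_meas. w y * (of_real (y - l) * p y))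
        - of_real \<delta> * (LINT y|I_meas. w y * p y)) \<le> N * (L2_norm p + L2_norm p')" if "H1_zero p p'" for p p'
    using weak[OF that] mult_left_mono[OF norm_le_sum N, of "L2_norm p" "L2_norm p'"] by (simp add: \<delta>_def)

  \<comment> \<open>Tested with the conjugate of w, the transport term is \<i> k R with R real and
    disappears from the real part.\<close>
  have energy: "E\<^sup>2 \<le> \<epsilon> * a\<^sup>2 + n * E"
  proof -
    define R where "R = (LINT y|I_meas. (y - l) * (norm (w y))\<^sup>2)"
    have R: "(LINT y|I_meas. w y * (of_real (y - l) * cnj (w y))) = of_real R"
    proof -
      have "w y * (of_real (y - l) * cnj (w y)) = of_real ((y - l) * (norm (w y))\<^sup>2)" for y
        by (simp only: of_real_mult complex_norm_square mult_ac)
      then show ?thesis unfolding R_def by (simp only: integral_complex_of_real)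
    qed
    have "\<nu> * (b\<^sup>2 + k\<^sup>2 * W\<^sup>2) - \<delta> * W\<^sup>2 = Re (of_real \<nu> * (of_real (b\<^sup>2) + of_real k ^ 2 * of_real (W\<^sup>2))
        + \<i> * of_real k * of_real R - of_real \<delta> * of_real (W\<^sup>2))"
      by (simp flip: of_real_power of_real_mult of_real_add)
    also have "\<dots> \<le> N * sqrt (W\<^sup>2 + b\<^sup>2)"
      using order_trans[OF complex_Re_le_cmod weak[OF H1_zero_cnj[OF w]]]
      unfolding integral_mult_cnj R L2_norm_cnj b_def W_def \<delta>_def .
    also have "\<dots> \<le> N * E"
      unfolding E_def using k2 N mult_right_mono[OF k2, of "W\<^sup>2"] by (intro mult_left_mono real_sqrt_le_mono) auto
    finally have "\<nu> * E\<^sup>2 \<le> \<delta> * W\<^sup>2 + N * E" unfolding E2 by simp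
    also have "\<delta> * W\<^sup>2 = \<nu> * (\<epsilon> * a\<^sup>2)" using h by (simp add: \<delta>_def W_eq power_mult_distrib)
    also have "\<nu> * (\<epsilon> * a\<^sup>2) + N * E = \<nu> * (\<epsilon> * a\<^sup>2 + n * E)" by (simp add: N_eq algebra_simps)
    finally show ?thesis using \<nu> by simp
  qed

  define \<rho>w where "\<rho>w = L2_norm (\<lambda>y. of_real (sqrt (weight l h y)) * w y)"
  have \<rho>w: "\<rho>w \<le> a" "\<rho>w\<^sup>2 \<le> 8 * (a * b)" "0 \<le> \<rho>w"
    using root_weight_mult_le[OF h(1) wL(1), of l] root_weight_mult_sq_le[OF h(1) w, of l] h(1)
    by (auto simp: \<rho>w_def a_def b_def)
  have \<nu>_h: "\<nu> / h = \<bar>k\<bar> * h\<^sup>2" unfolding h(3)[symmetric] using h(1) by (simp add: power2_eq_square power3_eq_cube)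

  have layer: "a\<^sup>2 \<le> 8 * a * b + (n + b) * (a + b) + n * a + E\<^sup>2 + \<epsilon> * a\<^sup>2"
  proof -
    have "\<bar>k\<bar> * norm (LINT y|I_meas. w y * cnj (w y))
      \<le> \<bar>k\<bar> * h\<^sup>2 * (\<rho>w * \<rho>w) + (N + \<nu> * b) * ((\<rho>w + b) / h) + (N + \<nu> * k\<^sup>2 * W + \<delta> * W) * \<rho>w"
      unfolding \<rho>w_def b_def W_def
      by (rule multiplier_estimate[OF h(1) wL w]) (use \<nu> N nn weak' in auto)
    also have "\<dots> \<le> \<bar>k\<bar> * h\<^sup>2 * (8 * (a * b)) + (N + \<nu> * b) * ((a + b) / h) + (N + \<nu> * k\<^sup>2 * W + \<delta> * W) * a"
      using \<rho>w \<nu> N nn h by (intro add_mono mult_left_mono divide_right_mono) (auto simp: power2_eq_square)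
    finally have "\<bar>k\<bar> * W\<^sup>2 \<le> \<dots>" unfolding integral_mult_cnj by (simp add: W_def norm_power)
    \<comment> \<open>After multiplication by h, the relation |k| h^3 = \<nu> lets \<nu> be
      cancelled throughout, leaving only a, b, n and E.\<close>
    then have "\<bar>k\<bar> * W\<^sup>2 * h \<le> (\<bar>k\<bar> * h\<^sup>2 * (8 * (a * b)) + (N + \<nu> * b) * ((a + b) / h) + (N + \<nu> * k\<^sup>2 * W + \<delta> * W) * a) * h"
      using h by (intro mult_right_mono) auto
    also have "\<bar>k\<bar> * W\<^sup>2 * h = \<nu> * a\<^sup>2"
      unfolding W_eq h(3)[symmetric] by (simp add: power2_eq_square power3_eq_cube mult_ac)
    also have "(\<bar>k\<bar> * h\<^sup>2 * (8 * (a * b)) + (N + \<nu> * b) * ((a + b) / h) + (N + \<nu> * k\<^sup>2 * W + \<delta> * W) * a) * h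
      = \<nu> * (8 * a * b + (n + b) * (a + b) + n * W + k\<^sup>2 * W\<^sup>2 + \<epsilon> * a\<^sup>2)"
    proof -
      have "\<bar>k\<bar> * h\<^sup>2 * h = \<nu>" using h(3) by (simp add: power2_eq_square power3_eq_cube)
      then have "\<bar>k\<bar> * h\<^sup>2 * (8 * (a * b)) * h = \<nu> * (8 * a * b)" by (metis mult.assoc mult.commute)
      moreover have "(N + \<nu> * b) * ((a + b) / h) * h = \<nu> * ((n + b) * (a + b))"
      proof -
        have "(N + \<nu> * b) * ((a + b) / h) * h = (N + \<nu> * b) * (a + b)" using h(1) by simp
        then show ?thesis by (simp add: N_eq algebra_simps)
      qed
      moreover have "(N + \<nu> * k\<^sup>2 * W + \<delta> * W) * a * h = (N + \<nu> * k\<^sup>2 * W + \<delta> * W) * W"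
        by (simp add: W_eq mult_ac)
      moreover have "(N + \<nu> * k\<^sup>2 * W + \<delta> * W) * W = \<nu> * (n * W + k\<^sup>2 * W\<^sup>2) + \<delta> * W\<^sup>2"
        by (simp add: N_eq power2_eq_square algebra_simps)
      moreover have "\<delta> * W\<^sup>2 = \<nu> * (\<epsilon> * a\<^sup>2)" using h by (simp add: \<delta>_def W_eq power_mult_distrib)
      ultimately show ?thesis by (simp add: distrib_left distrib_right)
    qed
    finally have "a\<^sup>2 \<le> 8 * a * b + (n + b) * (a + b) + n * W + k\<^sup>2 * W\<^sup>2 + \<epsilon> * a\<^sup>2" using \<nu> by simp
    moreover have "n * W \<le> n * a" using Wa nn by (intro mult_left_mono) auto
    moreover have "k\<^sup>2 * W\<^sup>2 \<le> E\<^sup>2" by (simp add: E2)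
    ultimately show ?thesis by linarith
  qed
  have En: "E \<le> 2 * n" and an: "a \<le> 33 * n"
    using energy_bootstrap[OF nn(3,1,5,2) \<epsilon> bE energy layer] by auto
  have \<nu>E: "\<nu> * E \<le> 2 * N" using mult_left_mono[OF En, of \<nu>] \<nu> by (simp add: N_eq)
  show \<nu>b: "\<nu> * L2_norm w' \<le> 2 * N" using order_trans[OF mult_left_mono[OF bE] \<nu>E] \<nu> unfolding b_def by simp
  show "\<nu> / h * L2_norm w \<le> 33 * N"
  proof -
    have "\<nu> * a \<le> \<nu> * (33 * n)" using an \<nu> by (intro mult_left_mono) auto
    then show ?thesis by (simp add: a_def N_eq)
  qed

  define P P' where "P = L2_norm \<phi>" and "P' = L2_norm \<phi>'"
  define U where "U = sqrt (P'\<^sup>2 + k\<^sup>2 * P\<^sup>2)"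
  have U0: "0 \<le> U" "0 \<le> P" "0 \<le> P'" by (auto simp: U_def P_def P'_def)
  have U2: "U\<^sup>2 = P'\<^sup>2 + k\<^sup>2 * P\<^sup>2" by (simp add: U_def)
  have P'U: "P' \<le> U" unfolding U_def by (rule real_le_rsqrt) simp
  have kPU: "\<bar>k\<bar> * P \<le> U" unfolding U_def by (rule real_le_rsqrt) (simp add: power_mult_distrib)
  \<comment> \<open>Integration by parts against the conjugate of \<phi> gives minus the squared
    velocity norm, so the pairing cannot cancel and its modulus is U^2.\<close>
  have pair: "norm (LINT y|I_meas. w y * cnj (\<phi> y)) = U\<^sup>2"
  proof -
    have wk: "(\<lambda>y. w y + of_real k ^ 2 * \<phi> y) \<in> L2" by (intro L2_add L2_cmult wL \<phi>L)
    have "(LINT y|I_meas. \<phi>' y * cnj (\<phi>' y)) = - (LINT y|I_meas. (w y + of_real k ^ 2 * \<phi> y) * cnj (\<phi> y))"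
      by (rule H1_zero_by_parts[OF H1_zero_cnj[OF \<phi>] \<phi>L(2) wk \<phi>w])
    also have "(LINT y|I_meas. (w y + of_real k ^ 2 * \<phi> y) * cnj (\<phi> y))
        = (LINT y|I_meas. w y * cnj (\<phi> y)) + of_real k ^ 2 * (LINT y|I_meas. \<phi> y * cnj (\<phi> y))"
      using L2_mult_integrable(1)[OF wL(1) L2_cnj[OF \<phi>L(1)]] L2_mult_integrable(1)[OF \<phi>L(1) L2_cnj[OF \<phi>L(1)]]
      by (simp add: distrib_right mult.assoc)
    finally have e: "of_real (P'\<^sup>2) = - ((LINT y|I_meas. w y * cnj (\<phi> y)) + of_real k ^ 2 * of_real (P\<^sup>2))"
      unfolding integral_mult_cnj P_def P'_def .
    have "x = - (p + q)" if "p = - (x + q)" for x p q :: complex using that by simp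
    from this[OF e] have "(LINT y|I_meas. w y * cnj (\<phi> y)) = - of_real (U\<^sup>2)"
      unfolding U2 by simp
    then show ?thesis by (simp add: norm_power)
  qed
  have "s * sqrt s * U \<le> 83 * N"
  proof (cases "1 \<le> s")
    case True
    \<comment> \<open>Together with |k| P \<le> U this yields |k| U \<le> W, hence \<nu> k^2 U \<le>
      \<nu> E \<le> 2 N; and \<nu> k^2 = s^3 dominates s sqrt s when s \<ge> 1.\<close>
    have "U\<^sup>2 \<le> W * P"
      using L2_Cauchy_Schwarz[OF wL(1) L2_cnj[OF \<phi>L(1)]] unfolding pair L2_norm_cnj W_def P_def .
    also have "\<bar>k\<bar> * (W * P) \<le> W * U" using mult_left_mono[OF kPU, of W] nn by (simp add: mult_ac)
    finally have "\<bar>k\<bar> * U * U \<le> W * U" using k by (simp add: power2_eq_square mult_left_mono mult.assoc)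
    then have kU: "\<bar>k\<bar> * U \<le> W" using nn U0 by (cases "U = 0") auto
    have "\<nu> * (\<bar>k\<bar> * (\<bar>k\<bar> * U)) \<le> \<nu> * (\<bar>k\<bar> * W)" using \<nu> kU by (intro mult_left_mono) auto
    also have "\<dots> \<le> 2 * N" using order_trans[OF mult_left_mono[OF kWE] \<nu>E] \<nu> by simp
    finally have "s ^ 3 * U \<le> 2 * N"
      unfolding h(3)[symmetric] s_def by (simp add: power_mult_distrib power3_eq_cube mult_ac)
    moreover have "s * sqrt s * U \<le> s ^ 3 * U"
    proof (intro mult_right_mono U0)
      have "sqrt s \<le> s" using True real_sqrt_le_mono[of s "s * s"] by simp
      also have "\<dots> \<le> s * s" using True by simp
      finally show "s * sqrt s \<le> s ^ 3" using s by (simp add: power3_eq_cube mult.assoc)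
    qed
    ultimately show ?thesis using N by linarith
  next
    case False
    then have s1: "s < 1" by simp
    define \<rho> where "\<rho> = L2_norm (\<lambda>y. of_real (sqrt (weight l h y)) * \<phi> y)"
    have \<rho>2: "\<rho>\<^sup>2 \<le> 8 / h * (P * P')"
      unfolding \<rho>_def P_def P'_def by (rule root_weight_mult_sq_le[OF h(1) \<phi>])
    \<comment> \<open>Both \<phi> and \<phi>' are controlled by U, the former with the extra factor
      1 / |k|; this turns the 1 / h in the weighted bound into 1 / s.\<close>
    have "2 * (\<bar>k\<bar> * P) * P' \<le> U\<^sup>2"
      using sum_squares_bound[of "\<bar>k\<bar> * P" P'] by (simp add: U2 power_mult_distrib)
    then have "8 / s * (\<bar>k\<bar> * P * P') \<le> 4 / s * U\<^sup>2" using s by (simp add: field_simps)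
    moreover have "8 / s * (\<bar>k\<bar> * P * P') = 8 / h * (P * P')" using k by (simp add: s_def field_simps)
    ultimately have "\<rho>\<^sup>2 \<le> 4 / s * U\<^sup>2" using \<rho>2 by simp
    also have "\<dots> = (2 * U / sqrt s)\<^sup>2" using s by (simp add: power_divide power_mult_distrib)
    finally have \<rho>: "\<rho> \<le> 2 * U / sqrt s" using U0 s by (auto intro: power2_le_imp_le)
    have \<rho>0: "0 \<le> \<rho>" by (simp add: \<rho>_def)
    have NN: "N \<le> N / h" using N h by (simp add: field_simps mult_left_le)
    have "\<bar>k\<bar> * U\<^sup>2 \<le> \<bar>k\<bar> * h\<^sup>2 * (\<rho>w * \<rho>) + (N + \<nu> * b) * ((\<rho> + P') / h) + (N + \<nu> * k\<^sup>2 * W + \<delta> * W) * \<rho>"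
      unfolding \<rho>w_def b_def W_def \<rho>_def P'_def pair[symmetric]
      by (rule multiplier_estimate[OF h(1) wL \<phi>]) (use \<nu> N nn weak' in auto)
    \<comment> \<open>33 is the bound on a; 3 = 1 + 2 adds the bound on \<nu> b; 4 = 1 + 2 + 1
      collects N, the k^2 term (through |k| h < 1) and the \<epsilon>-term. They lead to 40 = 33 + 3
      + 4 and 83 = 2 * 40 + 3.\<close>
    also have "\<dots> \<le> 33 * (N / h) * \<rho> + 3 * N * ((\<rho> + P') / h) + 4 * (N / h) * \<rho>"
    proof (intro add_mono)
      have "\<bar>k\<bar> * h\<^sup>2 * \<rho>w \<le> \<nu> / h * (33 * n)"
        unfolding \<nu>_h[symmetric] using \<rho>w(1) an h \<nu> by (intro mult_left_mono) auto
      also have "\<dots> = 33 * (N / h)" by (simp add: N_eq)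
      finally show "\<bar>k\<bar> * h\<^sup>2 * (\<rho>w * \<rho>) \<le> 33 * (N / h) * \<rho>"
        using mult_right_mono[OF _ \<rho>0] by (simp only: mult.assoc[symmetric])
      show "(N + \<nu> * b) * ((\<rho> + P') / h) \<le> 3 * N * ((\<rho> + P') / h)"
        using \<nu>b \<rho>0 U0 h by (intro mult_right_mono) (auto simp: b_def)
      have "\<nu> * k\<^sup>2 * W \<le> 2 * (N / h)"
      proof -
        have "\<nu> * k\<^sup>2 * W = \<bar>k\<bar> * (\<nu> * (\<bar>k\<bar> * W))"
          by (simp only: power2_abs[symmetric, of k] power2_eq_square mult_ac)
        also have "\<dots> \<le> \<bar>k\<bar> * (2 * N)"
          using order_trans[OF mult_left_mono[OF kWE] \<nu>E] \<nu> by (intro mult_left_mono) auto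
        also have "\<dots> \<le> 1 / h * (2 * N)"
          using s1 h N by (intro mult_right_mono) (auto simp: s_def field_simps)
        finally show ?thesis by simp
      qed
      moreover have "\<delta> * W \<le> N / h"
      proof -
        have "\<delta> * W = \<epsilon> * (\<nu> * a) / h" using h by (simp add: \<delta>_def W_eq power2_eq_square)
        also have "\<epsilon> * (\<nu> * a) \<le> 1/1000 * (\<nu> * (33 * n))"
          using \<epsilon> \<nu> an nn by (intro mult_mono mult_left_mono) auto
        also have "\<dots> \<le> N" using N by (simp add: N_eq)
        finally show ?thesis using h by (simp add: divide_right_mono)
      qed
      ultimately show "(N + \<nu> * k\<^sup>2 * W + \<delta> * W) * \<rho> \<le> 4 * (N / h) * \<rho>"
        using NN \<rho>0 by (intro mult_right_mono) auto
    qed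
    also have "\<dots> = N / h * (40 * \<rho> + 3 * P')" by (simp add: divide_inverse) (simp add: algebra_simps)
    also have "\<dots> \<le> N / h * (40 * (2 * U / sqrt s) + 3 * (U / sqrt s))"
    proof (intro mult_left_mono add_mono \<rho>)
      have "sqrt s \<le> 1" using s1 by simp
      then have "U \<le> U / sqrt s" using U0 s by (simp add: field_simps mult_left_le)
      then show "P' \<le> U / sqrt s" using P'U by simp
    qed (use N h in auto)
    also have "\<dots> = 83 * N * U / (h * sqrt s)" using h s by (simp add: field_simps)
    finally have "\<bar>k\<bar> * U\<^sup>2 * (h * sqrt s) \<le> 83 * N * U"
      using h s by (simp add: pos_le_divide_eq)
    then have "s * sqrt s * U * U \<le> 83 * N * U" by (simp add: s_def power2_eq_square mult_ac)
    then show ?thesis using U0 N by (cases "U = 0") auto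
  qed
  then show "(\<bar>k\<bar> * h) * sqrt (\<bar>k\<bar> * h) * sqrt ((L2_norm \<phi>')\<^sup>2 + k\<^sup>2 * (L2_norm \<phi>)\<^sup>2) \<le> 83 * N"
    by (simp add: s_def U_def P_def P'_def)
qed

section \<open>The Orr-Sommerfeld equation\<close>

text \<open>Passes the inequality, not the equation, to the limit: F is evaluated on test functions
  only, and its extension to H10 is replaced by the bound.\<close>

lemma H1_zero_limit_le:
  assumes p: "H1_zero p p'" and u: "u \<in> L2" and v: "v \<in> L2"
    and le: "\<And>\<psi>. \<psi> \<in> test_fun \<Longrightarrow> norm ((LINT y|I_meas. u y * \<psi> y) + (LINT y|I_meas. v y * vderiv \<psi> y))
      \<le> N * sqrt ((L2_norm \<psi>)\<^sup>2 + (L2_norm (vderiv \<psi>))\<^sup>2)"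
  shows "norm ((LINT y|I_meas. u y * p y) + (LINT y|I_meas. v y * p' y)) \<le> N * sqrt ((L2_norm p)\<^sup>2 + (L2_norm p')\<^sup>2)"
proof -
  obtain s where s: "\<And>n. s n \<in> test_fun" "L2_lim s p" "L2_lim (\<lambda>n. vderiv (s n)) p'"
    using H1_zeroE[OF p] by blast
  have "(\<lambda>n. norm ((LINT y|I_meas. u y * s n y) + (LINT y|I_meas. v y * vderiv (s n) y)))
     \<longlonglongrightarrow> norm ((LINT y|I_meas. u y * p y) + (LINT y|I_meas. v y * p' y))"
    by (intro tendsto_norm tendsto_add L2_lim_integral s u v)
  moreover have "(\<lambda>n. N * sqrt ((L2_norm (s n))\<^sup>2 + (L2_norm (vderiv (s n)))\<^sup>2))
     \<longlonglongrightarrow> N * sqrt ((L2_norm p)\<^sup>2 + (L2_norm p')\<^sup>2)"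
    by (intro tendsto_intros L2_lim_norm s)
  ultimately show ?thesis using le[OF s(1)] by (meson LIMSEQ_le)
qed

lemma Sobolev_weak_deriv: "f \<in> Sobolev m \<Longrightarrow> j \<le> m \<Longrightarrow> has_weak_deriv j f (weak_deriv j f)"
  unfolding Sobolev_def by (blast intro: has_weak_deriv_weak_deriv)

lemma has_weak_derivD:
  assumes "has_weak_deriv j f g"
  shows "f \<in> L2" "g \<in> L2"
    "\<psi> \<in> test_fun \<Longrightarrow> (LINT y|I_meas. f y * (vderiv ^^ j) \<psi> y) = (-1) ^ j * (LINT y|I_meas. g y * \<psi> y)"
  using assms by (auto simp: has_weak_deriv_def)

lemma Lap_distr_of:
  assumes \<phi>: "\<phi> \<in> Sobolev 3" and \<psi>: "\<psi> \<in> test_fun"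
  shows "Lap k (distr_of \<phi>) \<psi> = (LINT y|I_meas. vorticity k \<phi> y * \<psi> y)"
proof -
  note d2 = has_weak_derivD[OF Sobolev_weak_deriv[OF \<phi>, of 2], simplified numeral_2_eq_2]
  have "Lap k (distr_of \<phi>) \<psi> = (LINT y|I_meas. \<phi> y * vderiv (vderiv \<psi>) y) - of_int k ^ 2 * (LINT y|I_meas. \<phi> y * \<psi> y)"
    by (simp add: Lap_def distr_deriv_def distr_of_def)
  also have "(LINT y|I_meas. \<phi> y * vderiv (vderiv \<psi>) y) = (LINT y|I_meas. weak_deriv 2 \<phi> y * \<psi> y)"
    using d2(3)[OF _ \<psi>] by (simp add: numeral_2_eq_2)
  also have "\<dots> - of_int k ^ 2 * (LINT y|I_meas. \<phi> y * \<psi> y) = (LINT y|I_meas. vorticity k \<phi> y * \<psi> y)"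
    unfolding vorticity_def left_diff_distrib mult.assoc
    by (subst Bochner_Integration.integral_diff)
      (use d2(1,2) in \<open>auto intro!: L2_mult_integrable(1) integrable_mult_right test_fun_L2 \<psi> simp: numeral_2_eq_2\<close>)
  finally show ?thesis .
qed

text \<open>The weak derivatives of order 2 and 3 are both defined from \<phi>, not from each other.
  Testing the second with \<psi>' and the third with \<psi> gives the same integral of \<phi>
  against \<psi>''', which links them.\<close>

lemma vorticity_weak_deriv:
  assumes \<phi>: "\<phi> \<in> Sobolev 3"
  shows "has_weak_deriv 1 (vorticity k \<phi>) (\<lambda>y. weak_deriv 3 \<phi> y - of_int k ^ 2 * weak_deriv 1 \<phi> y)"
proof -
  note d = Sobolev_weak_deriv[OF \<phi>]
  have wd: "has_weak_deriv 1 \<phi> (weak_deriv 1 \<phi>)" "has_weak_deriv 2 \<phi> (weak_deriv 2 \<phi>)"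
    "has_weak_deriv 3 \<phi> (weak_deriv 3 \<phi>)" by (rule d, simp)+
  note d1 = has_weak_derivD[OF wd(1)] and d2 = has_weak_derivD[OF wd(2)] and d3 = has_weak_derivD[OF wd(3)]
  show ?thesis
    unfolding has_weak_deriv_def
  proof (intro conjI ballI)
    show "vorticity k \<phi> \<in> L2" unfolding vorticity_def by (intro L2_diff L2_cmult d1 d2)
    show "(\<lambda>y. weak_deriv 3 \<phi> y - of_int k ^ 2 * weak_deriv 1 \<phi> y) \<in> L2" by (intro L2_diff L2_cmult d1 d3)
    fix \<psi> assume \<psi>: "\<psi> \<in> test_fun"
    note \<psi>' = test_fun_vderiv[OF \<psi>]
    have "(LINT y|I_meas. weak_deriv 2 \<phi> y * vderiv \<psi> y) = (LINT y|I_meas. \<phi> y * (vderiv ^^ 3) \<psi> y)"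
      using d2(3)[OF \<psi>'] by (simp add: eval_nat_numeral)
    then have 1: "(LINT y|I_meas. weak_deriv 2 \<phi> y * vderiv \<psi> y) = - (LINT y|I_meas. weak_deriv 3 \<phi> y * \<psi> y)"
      using d3(3)[OF \<psi>] by simp
    have 2: "(LINT y|I_meas. \<phi> y * vderiv \<psi> y) = - (LINT y|I_meas. weak_deriv 1 \<phi> y * \<psi> y)"
      using d1(3)[OF \<psi>] by simp
    have "(LINT y|I_meas. vorticity k \<phi> y * vderiv \<psi> y)
        = (LINT y|I_meas. weak_deriv 2 \<phi> y * vderiv \<psi> y) - of_int k ^ 2 * (LINT y|I_meas. \<phi> y * vderiv \<psi> y)"
      unfolding vorticity_def left_diff_distrib mult.assoc
      by (subst Bochner_Integration.integral_diff)
        (auto intro!: L2_mult_integrable(1) integrable_mult_right test_fun_L2 \<psi>' d1 d2)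
    also have "\<dots> = - (LINT y|I_meas. (weak_deriv 3 \<phi> y - of_int k ^ 2 * weak_deriv 1 \<phi> y) * \<psi> y)"
      unfolding 1 2 using L2_mult_integrable(1)[OF d1(2) test_fun_L2[OF \<psi>]]
        L2_mult_integrable(1)[OF d3(2) test_fun_L2[OF \<psi>]]
      by (simp add: left_diff_distrib mult.assoc)
    finally show "(LINT y|I_meas. vorticity k \<phi> y * (vderiv ^^ 1) \<psi> y) =
      (-1) ^ 1 * (LINT y|I_meas. (weak_deriv 3 \<phi> y - of_int k ^ 2 * weak_deriv 1 \<phi> y) * \<psi> y)" by simp
  qed
qed

text \<open>One derivative of the fourth-order term falls on w and one stays on \<psi>: the form
  that makes sense for w in H^1 and F in H^{-1}.\<close>

lemma OS_equation_form:
  assumes \<phi>: "\<phi> \<in> Sobolev 3" and eq: "OS_equation \<epsilon> \<nu> k lam \<phi> F" and \<psi>: "\<psi> \<in> test_fun"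
  defines "w \<equiv> vorticity k \<phi>"
  defines "w' \<equiv> \<lambda>y. weak_deriv 3 \<phi> y - of_int k ^ 2 * weak_deriv 1 \<phi> y"
  shows "of_real \<nu> * ((LINT y|I_meas. w' y * vderiv \<psi> y) + of_int k ^ 2 * (LINT y|I_meas. w y * \<psi> y))
      + \<i> * of_int k * (LINT y|I_meas. w y * (of_real (y - lam) * \<psi> y))
      - of_real (\<epsilon> * \<nu> powr (1/3) * \<bar>real_of_int k\<bar> powr (2/3)) * (LINT y|I_meas. w y * \<psi> y) = F \<psi>"
proof -
  have sm: "smooth (\<lambda>y. of_real (y - lam))"
    using smooth_add[OF smooth_of_real smooth_const[of "- of_real lam"]] by simp
  have L: "Lap k (distr_of \<phi>) \<theta> = (LINT y|I_meas. w y * \<theta> y)" if "\<theta> \<in> test_fun" for \<theta>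
    unfolding w_def by (rule Lap_distr_of[OF \<phi> that])
  have "Lap k (Lap k (distr_of \<phi>)) \<psi> = Lap k (distr_of \<phi>) (vderiv (vderiv \<psi>)) - of_int k ^ 2 * Lap k (distr_of \<phi>) \<psi>"
    by (subst Lap_def) (simp add: distr_deriv_def)
  also have "\<dots> = (LINT y|I_meas. w y * vderiv (vderiv \<psi>) y) - of_int k ^ 2 * (LINT y|I_meas. w y * \<psi> y)"
    by (simp add: L \<psi> test_fun_vderiv)
  also have "(LINT y|I_meas. w y * vderiv (vderiv \<psi>) y) = - (LINT y|I_meas. w' y * vderiv \<psi> y)"
    unfolding w_def w'_def
    by (rule has_weak_deriv_1D(3)[OF vorticity_weak_deriv[OF \<phi>] test_fun_vderiv[OF \<psi>]])
  finally have LL: "Lap k (Lap k (distr_of \<phi>)) \<psi> =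
    - ((LINT y|I_meas. w' y * vderiv \<psi> y) + of_int k ^ 2 * (LINT y|I_meas. w y * \<psi> y))" by simp
  have M: "distr_mult (\<lambda>y. of_real (y - lam)) (Lap k (distr_of \<phi>)) \<psi> = (LINT y|I_meas. w y * (of_real (y - lam) * \<psi> y))"
    unfolding distr_mult_def by (rule L[OF test_fun_mult[OF \<psi> sm]])
  show ?thesis
    using eq[unfolded OS_equation_def, rule_format, OF \<psi>] unfolding LL M L[OF \<psi>] by (simp only: mult_minus_left mult_minus_right minus_minus)
qed

lemma L2_norm_velocity:
  assumes "weak_deriv 1 \<phi> \<in> L2" "\<phi> \<in> L2"
  shows "L2_norm (velocity k \<phi>) = sqrt ((L2_norm (weak_deriv 1 \<phi>))\<^sup>2 + (of_int k)\<^sup>2 * (L2_norm \<phi>)\<^sup>2)"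
proof -
  have "(norm (velocity k \<phi> y))\<^sup>2 = (norm (weak_deriv 1 \<phi> y))\<^sup>2 + (of_int k)\<^sup>2 * (norm (\<phi> y))\<^sup>2" for y
    by (simp add: velocity_def norm_Pair norm_mult power_mult_distrib)
  then have "(L2_norm (velocity k \<phi>))\<^sup>2 = (L2_norm (weak_deriv 1 \<phi>))\<^sup>2 + (of_int k)\<^sup>2 * (L2_norm \<phi>)\<^sup>2"
    unfolding L2_norm_power2 using L2D(2)[OF assms(1)] L2D(2)[OF assms(2)] by simp
  then show ?thesis by (metis L2_norm_nonneg real_sqrt_unique)
qed

text \<open>The two end point values may be witnessed by different continuous representatives; these
  agree a.e., hence on all of [-1,1].\<close>

lemma has_trace_zero_H1_zero:
  assumes "has_weak_deriv 1 f f'" and "has_trace f (-1) 0" "has_trace f 1 0"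
  shows "H1_zero f f'"
proof -
  obtain g where g: "continuous_on {-1..1} g" "AE y in I_meas. f y = g y" "g (-1) = 0"
    using assms(2) by (auto simp: has_trace_def)
  obtain g1 where g1: "continuous_on {-1..1} g1" "AE y in I_meas. f y = g1 y" "g1 1 = 0"
    using assms(3) by (auto simp: has_trace_def)
  have "g 1 - g1 1 = 0"
  proof (rule AE_continuous_zero)
    show "continuous_on {-1..1} (\<lambda>y. g y - g1 y)" by (intro continuous_intros g g1)
    show "AE y in I_meas. g y - g1 y = 0" using g(2) g1(2) by eventually_elim simp
  qed simp
  then have "g 1 = 0" using g1(3) by simp
  show ?thesis
    by (rule H1_zero_trace[OF has_weak_deriv_1D(1,2,3)[OF assms(1)] g \<open>g 1 = 0\<close>])
qed

lemma has_trace_vorticity: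
  assumes "has_trace (weak_deriv 2 \<phi>) a 0" "has_trace \<phi> a 0"
  shows "has_trace (vorticity k \<phi>) a 0"
proof -
  obtain g where g: "continuous_on {-1..1} g" "AE y in I_meas. weak_deriv 2 \<phi> y = g y" "g a = 0"
    using assms(1) by (auto simp: has_trace_def)
  obtain g1 where g1: "continuous_on {-1..1} g1" "AE y in I_meas. \<phi> y = g1 y" "g1 a = 0"
    using assms(2) by (auto simp: has_trace_def)
  have "AE y in I_meas. vorticity k \<phi> y = g y - of_int k ^ 2 * g1 y"
    using g(2) g1(2) by eventually_elim (simp add: vorticity_def)
  then show ?thesis unfolding has_trace_def
    using g g1 by (intro exI[of _ "\<lambda>y. g y - of_int k ^ 2 * g1 y"]) (auto intro!: continuous_intros)
qed

text \<open>The constant is 118 = 83 + 2 + 33, one summand for each term on the left.\<close>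

lemma OS_estimate:
  assumes \<epsilon>: "0 \<le> \<epsilon>" "\<epsilon> \<le> 1/1000" and \<nu>: "0 < \<nu>" "\<nu> \<le> 1" and k: "1 \<le> \<bar>k\<bar>"
    and F: "F \<in> Hminus1" and \<phi>: "\<phi> \<in> Sobolev 3" and eq: "OS_equation \<epsilon> \<nu> k lam \<phi> F"
    and tr: "has_trace \<phi> (-1) 0" "has_trace \<phi> 1 0"
       "has_trace (weak_deriv 2 \<phi>) (-1) 0" "has_trace (weak_deriv 2 \<phi>) 1 0"
  shows "(\<nu> * (real_of_int k)\<^sup>2) powr (1/2) * L2_norm (velocity k \<phi>)
       + \<nu> * L2_norm (weak_deriv 1 (vorticity k \<phi>))
       + \<nu> powr (2/3) * \<bar>real_of_int k\<bar> powr (1/3) * L2_norm (vorticity k \<phi>)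
       \<le> 118 * Hminus1_norm F"
proof -
  define N where "N = Hminus1_norm F"
  define K where "K = \<bar>real_of_int k\<bar>"
  define h where "h = (\<nu> / K) powr (1/3)"
  define w where "w = vorticity k \<phi>"
  define w' where "w' = (\<lambda>y. weak_deriv 3 \<phi> y - of_int k ^ 2 * weak_deriv 1 \<phi> y)"
  define \<phi>' where "\<phi>' = weak_deriv 1 \<phi>"
  have K: "1 \<le> K" using k by (simp add: K_def)
  have h0: "0 < h" using \<nu> K by (simp add: h_def)
  have h1: "h \<le> 1" using \<nu> K powr_mono2[of "1/3" "\<nu> / K" 1] by (simp add: h_def)
  have h3: "K * h ^ 3 = \<nu>"
    using \<nu> K by (simp add: h_def powr_power)
  have w_deriv: "has_weak_deriv 1 w w'" unfolding w_def w'_def by (rule vorticity_weak_deriv[OF \<phi>])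
  have \<phi>_deriv: "has_weak_deriv 1 \<phi> \<phi>'" unfolding \<phi>'_def by (rule Sobolev_weak_deriv[OF \<phi>]) simp
  have wz: "H1_zero w w'"
    by (rule has_trace_zero_H1_zero[OF w_deriv]) (auto simp: w_def intro!: has_trace_vorticity tr)
  have \<phi>z: "H1_zero \<phi> \<phi>'"
    by (rule has_trace_zero_H1_zero[OF \<phi>_deriv]) (auto intro!: tr)
  note wL = H1_zero_L2[OF wz] and \<phi>L = H1_zero_L2[OF \<phi>z]
  \<comment> \<open>In terms of h the prescribed powers of \<nu> and |k| are just \<nu> / h^2;
    similarly the weight of the vorticity norm further down is \<nu> / h.\<close>
  have \<delta>: "\<epsilon> * \<nu> powr (1/3) * K powr (2/3) = \<epsilon> * \<nu> / h\<^sup>2"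
  proof -
    have "h\<^sup>2 = (\<nu> / K) powr (2/3)" using \<nu> K by (simp add: h_def powr_power)
    then have 1: "h\<^sup>2 = \<nu> powr (2/3) / K powr (2/3)" using \<nu> K by (simp add: powr_divide)
    have 2: "\<nu> = \<nu> powr (1/3) * \<nu> powr (2/3)" using \<nu> by (simp flip: powr_add)
    have "\<epsilon> * a * d = \<epsilon> * c / x" if "x = b / d" "c = a * b" "b > 0" "d > 0" for a b c d x :: real
      using that by simp
    from this[OF 1 2] show ?thesis using \<nu> K by simp
  qed
  \<comment> \<open>The dual norm is a supremum, so its sign is read off from the duality bound at
    one test function of positive norm.\<close>
  have N: "0 \<le> N"
  proof -
    obtain \<eta> where \<eta>: "\<eta> \<in> test_fun" "(LINT y|I_meas. \<eta> y) = (1::complex)" using test_fun_integral_1 by blast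
    have "L2_norm \<eta> \<noteq> 0" using L2_Cauchy_Schwarz[OF test_fun_L2[OF \<eta>(1)] L2_const[of 1]] \<eta>(2) by auto
    then have "(L2_norm \<eta>)\<^sup>2 + (L2_norm (vderiv \<eta>))\<^sup>2 > 0" by (intro add_pos_nonneg) auto
    then have "0 < H1_norm \<eta>" unfolding test_fun_H1_norm[OF \<eta>(1)] by simp
    moreover have "0 \<le> N * H1_norm \<eta>" unfolding N_def by (rule order_trans[OF norm_ge_zero Hminus1_test_fun[OF F \<eta>(1)]])
    ultimately show ?thesis by (simp add: zero_le_mult_iff)
  qed
  have \<phi>w: "(LINT y|I_meas. \<phi>' y * vderiv \<psi> y) = - (LINT y|I_meas. (w y + of_real (of_int k) ^ 2 * \<phi> y) * \<psi> y)"
    if \<psi>: "\<psi> \<in> test_fun" for \<psi>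
  proof -
    have "(LINT y|I_meas. \<phi>' y * vderiv \<psi> y) = - (LINT y|I_meas. \<phi> y * vderiv (vderiv \<psi>) y)"
      using has_weak_deriv_1D(3)[OF \<phi>_deriv test_fun_vderiv[OF \<psi>]] by simp
    also have "(LINT y|I_meas. \<phi> y * vderiv (vderiv \<psi>) y) = (LINT y|I_meas. weak_deriv 2 \<phi> y * \<psi> y)"
      using has_weak_derivD(3)[OF Sobolev_weak_deriv[OF \<phi>, of 2] \<psi>] by (simp add: numeral_2_eq_2)
    finally show ?thesis by (simp add: w_def vorticity_def)
  qed
  \<comment> \<open>The form is split into the coefficient u of p and v of p', both in L2, as the
    density argument requires.\<close>
  define u where "u y = (of_real \<nu> * of_int k ^ 2 + \<i> * of_int k * of_real (y - lam) - of_real (\<epsilon> * \<nu> / h\<^sup>2)) * w y" for y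
  define v where "v y = of_real \<nu> * w' y" for y
  have uL: "u \<in> L2"
  proof -
    have c: "continuous_on {-1..1} (\<lambda>y. of_real \<nu> * of_int k ^ 2 + \<i> * of_int k * of_real (y - lam) - of_real (\<epsilon> * \<nu> / h\<^sup>2) :: complex)"
      by (intro continuous_intros)
    \<comment> \<open>A constant sequence, so that the limit lemma for continuous multipliers yields
      membership of the product in L2.\<close>
    have "L2_lim (\<lambda>n. w) w" using wL by (simp add: L2_lim_def)
    from L2_limD(2)[OF L2_lim_mult_continuous[OF this c]] show ?thesis by (simp add: u_def[abs_def])
  qed
  have vL: "v \<in> L2" unfolding v_def[abs_def] by (intro L2_cmult wL)
  have form: "(LINT y|I_meas. u y * p y) + (LINT y|I_meas. v y * p' y) =
      of_real \<nu> * ((LINT y|I_meas. w' y * p' y) + of_int k ^ 2 * (LINT y|I_meas. w y * p y))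
      + \<i> * of_int k * (LINT y|I_meas. w y * (of_real (y - lam) * p y))
      - of_real (\<epsilon> * \<nu> / h\<^sup>2) * (LINT y|I_meas. w y * p y)" if p: "p \<in> L2" "p' \<in> L2" for p p'
  proof -
    have pl: "(\<lambda>y. of_real (y - lam) * p y) \<in> L2"
    proof -
      have "L2_lim (\<lambda>n. p) p" using p by (simp add: L2_lim_def)
      from L2_limD(2)[OF L2_lim_mult_continuous[OF this, of "\<lambda>y. of_real (y - lam)"]] show ?thesis
        by (simp add: continuous_intros)
    qed
    have "(LINT y|I_meas. u y * p y) = (LINT y|I_meas. of_real \<nu> * of_int k ^ 2 * (w y * p y)
        + \<i> * of_int k * (w y * (of_real (y - lam) * p y)) - of_real (\<epsilon> * \<nu> / h\<^sup>2) * (w y * p y))"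
      by (simp add: u_def algebra_simps)
    also have "\<dots> = of_real \<nu> * of_int k ^ 2 * (LINT y|I_meas. w y * p y)
        + \<i> * of_int k * (LINT y|I_meas. w y * (of_real (y - lam) * p y)) - of_real (\<epsilon> * \<nu> / h\<^sup>2) * (LINT y|I_meas. w y * p y)"
      using L2_mult_integrable(1)[OF wL(1) p(1)] L2_mult_integrable(1)[OF wL(1) pl]
      by (subst Bochner_Integration.integral_diff, (simp; fail), (simp; fail), subst Bochner_Integration.integral_add) simp_all
    finally show ?thesis by (simp add: v_def algebra_simps)
  qed
  have weak: "norm (of_real \<nu> * ((LINT y|I_meas. w' y * p' y) + of_real (of_int k) ^ 2 * (LINT y|I_meas. w y * p y))
        + \<i> * of_real (of_int k) * (LINT y|I_meas. w y * (of_real (y - lam) * p y))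
        - of_real (\<epsilon> * \<nu> / h\<^sup>2) * (LINT y|I_meas. w y * p y)) \<le> N * sqrt ((L2_norm p)\<^sup>2 + (L2_norm p')\<^sup>2)"
    if p: "H1_zero p p'" for p p'
  proof -
    have "norm ((LINT y|I_meas. u y * p y) + (LINT y|I_meas. v y * p' y)) \<le> N * sqrt ((L2_norm p)\<^sup>2 + (L2_norm p')\<^sup>2)"
    proof (rule H1_zero_limit_le[OF p uL vL])
      fix \<psi> assume \<psi>: "\<psi> \<in> test_fun"
      have "(LINT y|I_meas. u y * \<psi> y) + (LINT y|I_meas. v y * vderiv \<psi> y) = F \<psi>"
        unfolding form[OF test_fun_L2[OF \<psi>] test_fun_L2[OF test_fun_vderiv[OF \<psi>]]]
        using OS_equation_form[OF \<phi> eq \<psi>] unfolding w_def w'_def \<delta>[symmetric] K_def .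
      then show "norm ((LINT y|I_meas. u y * \<psi> y) + (LINT y|I_meas. v y * vderiv \<psi> y))
          \<le> N * sqrt ((L2_norm \<psi>)\<^sup>2 + (L2_norm (vderiv \<psi>))\<^sup>2)"
        using Hminus1_test_fun[OF F \<psi>] by (simp add: N_def test_fun_H1_norm[OF \<psi>])
    qed
    then show ?thesis unfolding form[OF H1_zero_L2[OF p]] by simp
  qed
  note est = OS_form_estimates[where k="of_int k", OF \<nu>(1) _ \<epsilon> N h0 h1 _ wz \<phi>z \<phi>w weak, folded K_def, OF K h3]
  have 1: "\<nu> * L2_norm (weak_deriv 1 w) \<le> 2 * N"
    using est(1) L2_norm_weak_deriv[OF w_deriv] by simp
  have 2: "\<nu> powr (2/3) * K powr (1/3) * L2_norm w \<le> 33 * N"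
  proof -
    have "\<nu> powr (2/3) * K powr (1/3) = \<nu> / h"
    proof -
      have 1: "h = \<nu> powr (1/3) / K powr (1/3)" using \<nu> K by (simp add: h_def powr_divide)
      have 2: "\<nu> = \<nu> powr (1/3) * \<nu> powr (2/3)" using \<nu> by (simp flip: powr_add)
      have "b * d = c / x" if "x = a / d" "c = a * b" "a > 0" "d > 0" for a b c d x :: real
        using that by simp
      from this[OF 1 2] show ?thesis using \<nu> K by simp
    qed
    then show ?thesis using est(2) by simp
  qed
  have 3: "(\<nu> * (real_of_int k)\<^sup>2) powr (1/2) * L2_norm (velocity k \<phi>) \<le> 83 * N"
  proof -
    have Kk: "(real_of_int k)\<^sup>2 = K\<^sup>2" by (simp add: K_def)
    have Kh: "0 \<le> K * h" using K h0 by simp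
    have "\<nu> * K\<^sup>2 = (K * h) ^ 3" unfolding h3[symmetric] by (simp add: power2_eq_square power3_eq_cube mult_ac)
    also have "\<dots> = (K * h * sqrt (K * h))\<^sup>2" using Kh by (simp add: power_mult_distrib power2_eq_square power3_eq_cube)
    finally have "(\<nu> * K\<^sup>2) powr (1/2) = K * h * sqrt (K * h)"
      using Kh \<nu> by (simp add: powr_half_sqrt)
    moreover have "L2_norm (velocity k \<phi>) = sqrt ((L2_norm \<phi>')\<^sup>2 + K\<^sup>2 * (L2_norm \<phi>)\<^sup>2)"
      using L2_norm_velocity[OF \<phi>L(2)[unfolded \<phi>'_def] \<phi>L(1), of k] unfolding Kk \<phi>'_def .
    ultimately show ?thesis using est(3) unfolding Kk by simp
  qed
  show ?thesis using 1 2 3 by (simp add: K_def w_def N_def)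
qed

theorem proposition3p3:
  "\<exists>\<epsilon>0>0. \<exists>C>0. \<forall>\<epsilon>::real. \<forall>\<nu>::real. \<forall>k::int. \<forall>lam::real.
     \<forall>F::(real \<Rightarrow> complex) \<Rightarrow> complex. \<forall>\<phi>::real \<Rightarrow> complex.
       0 \<le> \<epsilon> \<and> \<epsilon> \<le> \<epsilon>0 \<and> 0 < \<nu> \<and> \<nu> \<le> 1 \<and> 1 \<le> \<bar>k\<bar> \<and> F \<in> Hminus1 \<and> \<phi> \<in> Sobolev 3 \<and>
       OS_equation \<epsilon> \<nu> k lam \<phi> F \<and>
       has_trace \<phi> (-1) 0 \<and> has_trace \<phi> 1 0 \<and>
       has_trace (weak_deriv 2 \<phi>) (-1) 0 \<and> has_trace (weak_deriv 2 \<phi>) 1 0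
       \<longrightarrow>
       (\<nu> * (real_of_int k)\<^sup>2) powr (1/2) * L2_norm (velocity k \<phi>)
       + \<nu> * L2_norm (weak_deriv 1 (vorticity k \<phi>))
       + \<nu> powr (2/3) * \<bar>real_of_int k\<bar> powr (1/3) * L2_norm (vorticity k \<phi>)
       \<le> C * Hminus1_norm F"
  using OS_estimate by (intro exI[of _ "1/1000"] exI[of _ 118] conjI allI impI) auto

end
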